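(* Let $S\subset[0,1]^n$ be a nonobtuse $0/1$-simplex whose fully indecomposable components are all acute. Then for every $(n-1)$-dimensional facet $F$ of $S$ that is not contained in an $(n-1)$-dimensional facet of $[0,1]^n$, there is at most one nonobtuse $0/1$-simplex $\hat S\neq S$ in $[0,1]^n$ having $F$ as a facet.
   Context: A $0/1$-simplex in $[0,1]^n$ is the convex hull of $n+1$ affinely independent points of $\{0,1\}^n$. A simplex is nonobtuse (resp. acute) if each dihedral angle ($\pi$ minus the angle between the inward normals of two facets) is at most (resp. less than) $\pi/2$; a $1$-simplex is regarded as acute. A matrix representation of $S$ is a matrix in $\{0,1\}^{n\times n}$ whose columns are, in some order, $\Pi(u\oplus w)$ for the vertices $u\neq w$ of $S$, with $w$ a fixed vertex of $S$, $\Pi$ a permutation matrix and $\oplus$ coordinatewise addition mod $2$. A matrix $A\in\{0,1\}^{m\times m}$ is partly decomposable if there exist $j\in\{1,\dots,m-1\}$ and permutation matrices $\Pi_1,\Pi_2$ with $\Pi_1^\top A\Pi_2=\begin{bmatrix}A_{11}&A_{12}\\0&A_{22}\end{bmatrix}$, $A_{11}$ of size $j\times j$; otherwise fully indecomposable. The fully indecomposable components of $S$: take a matrix representation $P$ of $S$ and permutation matrices $\Pi_1,\Pi_2$ such that $\Pi_1P\Pi_2$ is block upper triangular with square fully indecomposable diagonal blocks $A_1,\dots,A_p$ ($A_i\in\{0,1\}^{k_i\times k_i}$, $k_1+\dots+k_p=n$); the components are the simplices $\mathrm{conv}\{0,\text{columns of }A_i\}\subset\mathbb{R}^{k_i}$.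 A face-to-face neighbor of $S$ at a facet $F$ is a $0/1$-simplex in $[0,1]^n$ other than $S$ having $F$ as a facet. *)

theory Defs
  imports
    "HOL-Analysis.Analysis"
    "HOL-Combinatorics.Permutations"
    "Jordan_Normal_Form.Matrix"
begin

text \<open>
  Geometry takes place in \<^typ>\<open>real^'n\<close>. Matrices are the dimension-carrying
  \<^typ>\<open>real mat\<close>, since the sizes of the diagonal blocks vary.
\<close>

no_notation vec_index (infixl "$" 100)
no_notation scalar_prod (infix "\<bullet>" 70)

definition zero_one_simplex :: "(real^'n) set \<Rightarrow> bool" where
  "zero_one_simplex S \<longleftrightarrow>
     (\<exists>V. (\<forall>v\<in>V. \<forall>i. v $ i \<in> {0, 1}) \<and> \<not> affine_dependent V
        \<and> card V = CARD('n) + 1 \<and> S = convex hull V)"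

definition vector_angle :: "'a::real_inner \<Rightarrow> 'a \<Rightarrow> real" where
  "vector_angle u v = arccos ((u \<bullet> v) / (norm u * norm v))"

text \<open>
  Normals are taken inside the direction space of the affine hull of \<open>T\<close>, so that for a
  simplex lying in a coordinate subspace they are its normals as a simplex in that subspace.
\<close>

definition inward_normal :: "'a::euclidean_space set \<Rightarrow> 'a set \<Rightarrow> 'a \<Rightarrow> bool" where
  "inward_normal T F u \<longleftrightarrow>
     u \<noteq> 0 \<and> u \<in> span {x - y | x y. x \<in> T \<and> y \<in> T}
     \<and> (\<forall>x\<in>F. \<forall>y\<in>F. u \<bullet> (x - y) = 0)
     \<and> (\<forall>x\<in>T. \<forall>y\<in>F. u \<bullet> (x - y) \<ge> 0)"

definition is_dihedral_angle ::
    "'a::euclidean_space set \<Rightarrow> 'a set \<Rightarrow> 'a set \<Rightarrow> real \<Rightarrow> bool" where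
  "is_dihedral_angle T F G \<theta> \<longleftrightarrow>
     F facet_of T \<and> G facet_of T \<and> F \<noteq> G
     \<and> (\<exists>u v. inward_normal T F u \<and> inward_normal T G v \<and> \<theta> = pi - vector_angle u v)"

definition nonobtuse :: "'a::euclidean_space set \<Rightarrow> bool" where
  "nonobtuse T \<longleftrightarrow> (\<forall>F G \<theta>. is_dihedral_angle T F G \<theta> \<longrightarrow> \<theta> \<le> pi / 2)"

text \<open>
  A \<open>1\<close>-simplex needs no separate clause: the inward normals at its two end points are
  opposite, so its only dihedral angle is \<open>0\<close>.
\<close>

definition acute :: "'a::euclidean_space set \<Rightarrow> bool" where
  "acute T \<longleftrightarrow> (\<forall>F G \<theta>. is_dihedral_angle T F G \<theta> \<longrightarrow> \<theta> < pi / 2)"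

text \<open>
  The coordinates of \<^typ>\<open>real^'n\<close> are numbered \<open>0, \<dots>, CARD('n) - 1\<close> by the enumeration
  \<^term>\<open>from_nat_into (UNIV :: 'n set)\<close>. In \<open>of_coords\<close> a vector of dimension
  \<open>k \<le> CARD('n)\<close> is padded with zeros, which embeds \<open>k\<close>-space isometrically as the
  subspace of the first \<open>k\<close> coordinates.
\<close>

definition to_coords :: "real^'n \<Rightarrow> real vec" where
  "to_coords x = Matrix.vec CARD('n) (\<lambda>i. x $ from_nat_into UNIV i)"

definition of_coords :: "real vec \<Rightarrow> real^'n" where
  "of_coords v = (\<Sum>i<dim_vec v. vec_index v i *\<^sub>R axis (from_nat_into UNIV i) 1)"

text \<open>Coordinatewise addition mod \<open>2\<close> of vectors with entries in \<open>{0, 1}\<close>.\<close>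

definition add_mod2 :: "real^'n \<Rightarrow> real^'n \<Rightarrow> real^'n" where
  "add_mod2 u w = (\<chi> i. if u $ i = w $ i then 0 else 1)"

definition permutation_matrix :: "nat \<Rightarrow> real mat \<Rightarrow> bool" where
  "permutation_matrix m Q \<longleftrightarrow>
     (\<exists>\<sigma>. \<sigma> permutes {..<m} \<and> Q = Matrix.mat m m (\<lambda>(i, j). if i = \<sigma> j then 1 else 0))"

definition matrix_representation :: "(real^'n) set \<Rightarrow> real mat \<Rightarrow> bool" where
  "matrix_representation S P \<longleftrightarrow>
     P \<in> carrier_mat CARD('n) CARD('n)
     \<and> (\<exists>w Q us. w extreme_point_of S \<and> permutation_matrix CARD('n) Q
          \<and> distinct us \<and> set us = {u. u extreme_point_of S \<and> u \<noteq> w}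
          \<and> cols P = map (\<lambda>u. Q *\<^sub>v to_coords (add_mod2 u w)) us)"

definition partly_decomposable :: "real mat \<Rightarrow> bool" where
  "partly_decomposable A \<longleftrightarrow>
     (let m = dim_row A in
      \<exists>j Q1 Q2 A11 A12 A22.
        1 \<le> j \<and> j < m \<and> permutation_matrix m Q1 \<and> permutation_matrix m Q2
        \<and> A11 \<in> carrier_mat j j \<and> A12 \<in> carrier_mat j (m - j)
        \<and> A22 \<in> carrier_mat (m - j) (m - j)
        \<and> transpose_mat Q1 * A * Q2 = four_block_mat A11 A12 (0\<^sub>m (m - j) j) A22)"

definition fully_indecomposable :: "real mat \<Rightarrow> bool" where
  "fully_indecomposable A \<longleftrightarrow>
     square_mat A \<and> dim_row A \<ge> 1 \<and> elements_mat A \<subseteq> {0, 1} \<and> \<not> partly_decomposable A"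

primrec block_upper_triangular :: "real mat list \<Rightarrow> real mat \<Rightarrow> bool" where
  "block_upper_triangular [] M \<longleftrightarrow> M \<in> carrier_mat 0 0"
| "block_upper_triangular (A # As) M \<longleftrightarrow>
     (\<exists>k m B D. A \<in> carrier_mat k k \<and> B \<in> carrier_mat k m \<and> D \<in> carrier_mat m m
        \<and> block_upper_triangular As D \<and> M = four_block_mat A B (0\<^sub>m m k) D)"

definition fully_indecomposable_blocks :: "(real^'n) set \<Rightarrow> real mat list \<Rightarrow> bool" where
  "fully_indecomposable_blocks S As \<longleftrightarrow>
     (\<exists>P Q1 Q2. matrix_representation S P
        \<and> permutation_matrix CARD('n) Q1 \<and> permutation_matrix CARD('n) Q2
        \<and> block_upper_triangular As (Q1 * P * Q2)
        \<and> (\<forall>A\<in>set As. fully_indecomposable A))"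

definition component_simplex :: "real mat \<Rightarrow> (real^'n) set" where
  "component_simplex A = convex hull (insert 0 (of_coords ` set (cols A)))"

end

theory Submission
  imports Defs
begin

text \<open>
  Let \<open>q a\<close> be the gradient of the barycentric coordinate of the vertex \<open>a\<close> of \<open>S\<close>, and join \<open>a\<close> and
  \<open>b\<close> by an edge if \<open>q a \<bullet> q b < 0\<close>. Since \<open>q a = (\<Sum>b. - (q b \<bullet> q a) *\<^sub>R (a - b))\<close> with nonnegative
  coefficients, a nonzero \<open>k\<close>-th coordinate of \<open>q a\<close> determines \<open>a $ k\<close> by its sign, and the coordinate
  vanishes iff \<open>a\<close> agrees with all its neighbours in \<open>k\<close>. So the apex of a nonobtuse simplex over \<open>F\<close>
  is determined, up to the side of \<open>F\<close>, outside the zero set of the normal of \<open>F\<close>.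

  Every edge changes coordinates of one block only. Acuteness of the components makes the edges
  belonging to a block the edges of a clique, so that the graph is a tree of cliques. Hence two
  vertices of \<open>F\<close> agreeing on the zero set of the normal agree there with the apex of \<open>S\<close>. The foot of
  the altitude of another nonobtuse simplex over \<open>F\<close> is a convex combination of such vertices, at least
  two of them unless \<open>F\<close> lies in a facet of the cube; so its apex agrees there with the apex of \<open>S\<close> too.
\<close>

section \<open>Gradients of barycentric coordinates\<close>

text \<open>The family is indexed so that the vertices of a component simplex can carry the names of
  vertices of \<open>V\<close>. Only differences are tested, so \<open>g a\<close> is fixed only
  modulo the orthogonal complement of the direction space.\<close>

definition barycentric_gradients :: "'i set \<Rightarrow> ('i \<Rightarrow> 'a::real_inner) \<Rightarrow> ('i \<Rightarrow> 'a) \<Rightarrow> bool" where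
  "barycentric_gradients I f g \<longleftrightarrow>
     (\<forall>a\<in>I. \<forall>b\<in>I. \<forall>c\<in>I. g a \<bullet> (f b - f c) = of_bool (a = b) - of_bool (a = c))"

lemma barycentric_gradientsD:
  "barycentric_gradients I f g \<Longrightarrow> a \<in> I \<Longrightarrow> b \<in> I \<Longrightarrow> c \<in> I
    \<Longrightarrow> g a \<bullet> (f b - f c) = of_bool (a = b) - of_bool (a = c)"
  unfolding barycentric_gradients_def by blast

lemma barycentric_gradients_inj_on:
  assumes "barycentric_gradients I f g"
  shows "inj_on f I"
proof (rule inj_onI, rule ccontr)
  fix a b assume ab: "a \<in> I" "b \<in> I" "f a = f b" "a \<noteq> b"
  with barycentric_gradientsD[OF assms, of a a b] show False by simp
qed

lemma barycentric_gradients_affine_independent: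
  assumes bg: "barycentric_gradients I f g" and fin: "finite I"
  shows "\<not> affine_dependent (f ` I)"
proof
  have inj: "inj_on f I" by (rule barycentric_gradients_inj_on[OF bg])
  assume "affine_dependent (f ` I)"
  then obtain U v where U: "sum U (f ` I) = 0" "v \<in> f ` I" "U v \<noteq> 0"
      "(\<Sum>v\<in>f ` I. U v *\<^sub>R v) = 0"
    using fin by (auto simp: affine_dependent_explicit_finite)
  have U0: "(\<Sum>b\<in>I. U (f b)) = 0" "(\<Sum>b\<in>I. U (f b) *\<^sub>R f b) = 0"
    using U inj by (simp_all add: sum.reindex o_def)
  obtain a where a: "a \<in> I" "v = f a" using U(2) by blast
  \<comment> \<open>Pairing with \<open>g a\<close> isolates the coefficient of \<open>f a\<close>
    in the vanishing affine combination.\<close>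
  have "0 = g a \<bullet> ((\<Sum>b\<in>I. U (f b) *\<^sub>R f b) - (\<Sum>b\<in>I. U (f b)) *\<^sub>R f a)"
    by (simp add: U0)
  also have "\<dots> = (\<Sum>b\<in>I. U (f b) * (g a \<bullet> (f b - f a)))"
    by (simp add: inner_diff_right inner_sum_right scaleR_left.sum sum_subtractf right_diff_distrib)
  also have "\<dots> = (\<Sum>b\<in>I. U (f b) * (of_bool (a = b) - 1))"
    using a by (intro sum.cong) (simp_all add: barycentric_gradientsD[OF bg])
  also have "\<dots> = U (f a) - (\<Sum>b\<in>I. U (f b))"
    using a fin by (simp add: right_diff_distrib sum_subtractf of_bool_def if_distrib[of "\<lambda>x. _ * x"] cong: if_cong)
  finally show False using U U0 a by simp
qed

section \<open>Facets, inward normals and dihedral angles\<close>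

lemma facet_opposite_vertex:
  fixes f :: "'i \<Rightarrow> 'a::euclidean_space"
  assumes bg: "barycentric_gradients I f g" and fin: "finite I"
    and a: "a \<in> I" and c: "c \<in> I" "c \<noteq> a"
  shows "convex hull (f ` (I - {a})) facet_of convex hull (f ` I)"
proof -
  have inj: "inj_on f I" by (rule barycentric_gradients_inj_on[OF bg])
  have "f ` (I - {a}) = f ` I - {f a}"
    using inj a by (auto simp: inj_on_def)
  moreover have "convex hull (f ` (I - {a})) \<noteq> {}" using c by auto
  ultimately show ?thesis
    using a facet_of_convex_hull_affine_independent
      [OF barycentric_gradients_affine_independent[OF bg fin]] by auto
qed

text \<open>The barycentric coordinate of \<open>a\<close> is constant on the opposite facet and
  nowhere smaller on the simplex. The span hypothesis places its gradient in the direction space, as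
  \<open>inward_normal\<close> demands.\<close>

lemma inward_normal_gradient:
  fixes f :: "'i \<Rightarrow> 'a::euclidean_space"
  assumes bg: "barycentric_gradients I f g"
    and a: "a \<in> I" and c: "c \<in> I" "c \<noteq> a"
    and span: "g a \<in> span {f b - f c | b c. b \<in> I \<and> c \<in> I}"
  shows "inward_normal (convex hull (f ` I)) (convex hull (f ` (I - {a}))) (g a)"
proof -
  let ?T = "convex hull (f ` I)" and ?F = "convex hull (f ` (I - {a}))"
  have 0: "g a \<noteq> 0"
    using barycentric_gradientsD[OF bg a a c(1)] c by auto
  have "{f b - f c | b c. b \<in> I \<and> c \<in> I} \<subseteq> {x - y | x y. x \<in> ?T \<and> y \<in> ?T}"
    by (blast intro: hull_inc)
  then have 1: "g a \<in> span {x - y | x y. x \<in> ?T \<and> y \<in> ?T}"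
    using span span_mono by blast
  have 2: "g a \<bullet> x = g a \<bullet> f c" if "x \<in> ?F" for x
  proof -
    have "?F \<subseteq> {x. g a \<bullet> x = g a \<bullet> f c}"
    proof (rule hull_minimal)
      show "f ` (I - {a}) \<subseteq> {x. g a \<bullet> x = g a \<bullet> f c}"
      proof clarsimp
        fix b assume "b \<in> I" "b \<noteq> a"
        then show "g a \<bullet> f b = g a \<bullet> f c"
          using barycentric_gradientsD[OF bg a _ c(1), of b] c by (simp add: inner_diff_right)
      qed
    qed (rule convex_hyperplane)
    then show ?thesis using that by blast
  qed
  have 3: "g a \<bullet> x \<ge> g a \<bullet> f c" if "x \<in> ?T" for x
  proof -
    have "?T \<subseteq> {x. g a \<bullet> x \<ge> g a \<bullet> f c}"
    proof (rule hull_minimal)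
      show "f ` I \<subseteq> {x. g a \<bullet> x \<ge> g a \<bullet> f c}"
      proof clarsimp
        fix b assume "b \<in> I"
        then show "g a \<bullet> f b \<ge> g a \<bullet> f c"
          using barycentric_gradientsD[OF bg a _ c(1), of b] c
          by (simp add: inner_diff_right of_bool_def split: if_splits)
      qed
    qed (rule convex_halfspace_ge)
    then show ?thesis using that by blast
  qed
  show ?thesis
    unfolding inward_normal_def using 0 1 2 3 by (auto simp: inner_diff_right)
qed

lemma vector_angle_le_pi_half:
  assumes "u \<bullet> v \<ge> 0" shows "vector_angle u v \<le> pi / 2"
proof -
  have "u \<bullet> v / (norm u * norm v) \<le> 1"
    using norm_cauchy_schwarz[of u v] by (auto simp: divide_le_eq_1)
  then show ?thesis
    unfolding vector_angle_def using assms by (intro arccos_le_pi2) simp_all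
qed

lemma vector_angle_less_pi_half:
  assumes "u \<bullet> v > 0" shows "vector_angle u v < pi / 2"
proof -
  have "u \<noteq> 0" "v \<noteq> 0" using assms by auto
  then have pos: "norm u * norm v > 0" by simp
  then have "u \<bullet> v / (norm u * norm v) \<le> 1"
    using norm_cauchy_schwarz[of u v] by (simp add: divide_le_eq_1)
  moreover have "u \<bullet> v / (norm u * norm v) > 0" using assms pos by simp
  ultimately show ?thesis
    unfolding vector_angle_def using arccos_less_arccos[of 0] by simp
qed

text \<open>The gradients are inward normals, so the dihedral angle is \<open>pi\<close> minus the
  angle between them. A positive inner product would make it obtuse, and a nonnegative one already
  contradicts acuteness.\<close>

lemma
  fixes f :: "'i \<Rightarrow> 'a::euclidean_space"
  assumes bg: "barycentric_gradients I f g" and fin: "finite I"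
    and ab: "a \<in> I" "b \<in> I" "a \<noteq> b"
    and span: "\<And>a. a \<in> I \<Longrightarrow> g a \<in> span {f b - f c | b c. b \<in> I \<and> c \<in> I}"
  shows nonobtuse_gradients: "nonobtuse (convex hull (f ` I)) \<Longrightarrow> g a \<bullet> g b \<le> 0"
    and acute_gradients: "acute (convex hull (f ` I)) \<Longrightarrow> g a \<bullet> g b < 0"
proof -
  let ?T = "convex hull (f ` I)" and ?F = "\<lambda>a. convex hull (f ` (I - {a}))"
  have na: "inward_normal ?T (?F a) (g a)" and nb: "inward_normal ?T (?F b) (g b)"
    by (rule inward_normal_gradient[OF bg ab(1,2) ab(3)[symmetric] span[OF ab(1)]],
        rule inward_normal_gradient[OF bg ab(2,1,3) span[OF ab(2)]])
  have "?F a \<noteq> ?F b"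
  proof
    assume eq: "?F a = ?F b"
    have "f b \<in> ?F a" using ab by (auto intro!: hull_inc)
    moreover have "f a \<in> ?F a" unfolding eq using ab by (auto intro!: hull_inc)
    ultimately have "g a \<bullet> (f a - f b) = 0"
      using na unfolding inward_normal_def by blast
    then show False using barycentric_gradientsD[OF bg, of a a b] ab by simp
  qed
  then have "is_dihedral_angle ?T (?F a) (?F b) (pi - vector_angle (g a) (g b))"
    unfolding is_dihedral_angle_def
    using na nb facet_opposite_vertex[OF bg fin ab(1,2) ab(3)[symmetric]]
      facet_opposite_vertex[OF bg fin ab(2,1,3)] by blast
  then show "nonobtuse ?T \<Longrightarrow> g a \<bullet> g b \<le> 0" "acute ?T \<Longrightarrow> g a \<bullet> g b < 0"
    unfolding nonobtuse_def acute_def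
    using vector_angle_le_pi_half[of "g a" "g b"] vector_angle_less_pi_half[of "g a" "g b"]
    by (force simp: not_le not_less)+
qed

section \<open>Full-dimensional simplices: edge vectors and gradients as dual bases\<close>

lemma
  fixes V :: "'a::euclidean_space set"
  assumes aff: "\<not> affine_dependent V" and card: "card V = DIM('a) + 1" and c: "c \<in> V"
  shows independent_vertex_differences: "independent ((\<lambda>x. x - c) ` (V - {c}))"
    and span_vertex_differences: "span ((\<lambda>x. x - c) ` (V - {c})) = UNIV"
proof -
  let ?B = "(\<lambda>x. x - c) ` (V - {c})"
  show ind: "independent ?B"
    using aff affine_dependent_iff_dependent2[OF c] by simp
  have "finite V" using card card.infinite by fastforce
  then have "card ?B = DIM('a)"
    using card c by (simp add: card_image inj_on_def)
  then show "span ?B = UNIV"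
    using card_ge_dim_independent[of ?B UNIV] ind by (auto simp: dim_UNIV)
qed

lemma barycentric_gradients_exist:
  fixes V :: "'a::euclidean_space set"
  assumes aff: "\<not> affine_dependent V" and card: "card V = DIM('a) + 1"
  obtains q where "barycentric_gradients V id q"
proof -
  have "\<exists>y. \<forall>b\<in>V. \<forall>c\<in>V. y \<bullet> (b - c) = of_bool (a = b) - of_bool (a = c)" if a: "a \<in> V" for a
  proof -
    have "V \<noteq> {a}" using card by auto
    then obtain c where c: "c \<in> V" "c \<noteq> a" using a by blast
    \<comment> \<open>The edge vectors from \<open>c\<close> form a basis. \<open>h\<close> is the
      coordinate functional of \<open>a - c\<close>, and its adjoint at 1 is the vector representing
      it.\<close>
    obtain h :: "'a \<Rightarrow> real" where h: "linear h"
        "\<And>x. x \<in> (\<lambda>x. x - c) ` (V - {c}) \<Longrightarrow> h x = of_bool (x = a - c)"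
      using linear_independent_extend[OF independent_vertex_differences[OF aff card c(1)],
          of "\<lambda>x. of_bool (x = a - c)"] by blast
    define y where "y = adjoint h 1"
    have y: "y \<bullet> x = h x" for x
      using adjoint_works[OF h(1), of x 1] by (simp add: y_def inner_commute)
    have "y \<bullet> (b - c) = of_bool (a = b)" if "b \<in> V" for b
      using h(2)[of "b - c"] that c by (cases "b = c") (auto simp: y)
    then have "y \<bullet> (b - d) = of_bool (a = b) - of_bool (a = d)" if "b \<in> V" "d \<in> V" for b d
      using that by (simp add: inner_diff_right algebra_simps)
    then show ?thesis by blast
  qed
  then obtain q where "\<forall>a\<in>V. \<forall>b\<in>V. \<forall>c\<in>V. q a \<bullet> (b - c) = of_bool (a = b) - of_bool (a = c)"
    by metis
  then show ?thesis by (intro that) (simp add: barycentric_gradients_def)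
qed

text \<open>Both sides are linear in \<open>y\<close> and agree on the edge vectors from
  \<open>c\<close>, which span the space. The summand for \<open>b = c\<close> is zero, so the sum
  may run over all of \<open>V\<close>.\<close>

lemma barycentric_gradients_expansion:
  fixes V :: "'a::euclidean_space set"
  assumes bg: "barycentric_gradients V id q" and card: "card V = DIM('a) + 1" and c: "c \<in> V"
  shows "(\<Sum>b\<in>V. (q b \<bullet> y) *\<^sub>R (b - c)) = y"
proof -
  have fin: "finite V" using card card.infinite by fastforce
  have aff: "\<not> affine_dependent V"
    using barycentric_gradients_affine_independent[OF bg fin] by simp
  have "linear (\<lambda>y. \<Sum>b\<in>V. (q b \<bullet> y) *\<^sub>R (b - c))"
    by (rule linearI) (simp_all add: inner_add_right scaleR_left_distrib sum.distrib scaleR_sum_right)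
  moreover have "linear (\<lambda>y::'a. y)" by (rule linearI) simp_all
  moreover have "(\<Sum>b\<in>V. (q b \<bullet> y) *\<^sub>R (b - c)) = y" if "y \<in> (\<lambda>x. x - c) ` (V - {c})" for y
  proof -
    obtain d where d: "d \<in> V" "y = d - c" using \<open>y \<in> _\<close> by blast
    have "(\<Sum>b\<in>V. (q b \<bullet> y) *\<^sub>R (b - c))
        = (\<Sum>b\<in>V. of_bool (b = d) *\<^sub>R (b - c) - of_bool (b = c) *\<^sub>R (b - c))"
      using barycentric_gradientsD[OF bg _ d(1) c]
      by (intro sum.cong) (simp_all add: d scaleR_left_diff_distrib)
    also have "\<dots> = d - c"
      using fin c d by (simp add: sum_subtractf of_bool_def if_distrib[of "\<lambda>x. x *\<^sub>R _"] cong: if_cong)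
    finally show ?thesis by (simp add: d)
  qed
  ultimately show ?thesis
    using linear_eq_on_span[of _ "\<lambda>y. y" "(\<lambda>x. x - c) ` (V - {c})" y]
      span_vertex_differences[OF aff card c] by blast
qed

lemma barycentric_gradients_dual_expansion:
  fixes V :: "'a::euclidean_space set"
  assumes bg: "barycentric_gradients V id q" and card: "card V = DIM('a) + 1" and c: "c \<in> V"
  shows "(\<Sum>b\<in>V. (y \<bullet> (b - c)) *\<^sub>R q b) = y"
proof -
  have "(\<Sum>b\<in>V. (y \<bullet> (b - c)) *\<^sub>R q b) \<bullet> x = y \<bullet> x" for x
  proof -
    have "(\<Sum>b\<in>V. (y \<bullet> (b - c)) *\<^sub>R q b) \<bullet> x = y \<bullet> (\<Sum>b\<in>V. (q b \<bullet> x) *\<^sub>R (b - c))"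
      by (simp add: inner_sum_left inner_sum_right mult.commute)
    then show ?thesis by (simp add: barycentric_gradients_expansion[OF assms])
  qed
  then show ?thesis using vector_eq_rdot by blast
qed

text \<open>The barycentric coordinates sum to the constant 1, so their gradients cancel.\<close>

lemma barycentric_gradients_sum:
  fixes V :: "'a::euclidean_space set"
  assumes bg: "barycentric_gradients V id q" and card: "card V = DIM('a) + 1"
  shows "(\<Sum>b\<in>V. q b) = 0"
proof -
  have fin: "finite V" using card card.infinite by fastforce
  obtain c where c: "c \<in> V" using card by fastforce
  have "(\<Sum>b\<in>V. q b) \<bullet> (d - c) = 0" if "d \<in> V" for d
    using barycentric_gradientsD[OF bg _ that c] fin that c
    by (simp add: inner_sum_left sum_subtractf of_bool_def cong: if_cong)
  then show ?thesis
    using barycentric_gradients_dual_expansion[OF bg card c, of "\<Sum>b\<in>V. q b"] by simp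
qed

section \<open>The adjacency graph of a nonobtuse 0/1-simplex\<close>

locale nonobtuse_vertices =
  fixes V :: "(real^'n) set" and q :: "real^'n \<Rightarrow> real^'n"
  assumes bary: "barycentric_gradients V id q"
    and card_V: "card V = CARD('n) + 1"
    and cube: "\<And>v i. v \<in> V \<Longrightarrow> v $ i = 0 \<or> v $ i = 1"
    and gram_nonpos: "\<And>a b. a \<in> V \<Longrightarrow> b \<in> V \<Longrightarrow> a \<noteq> b \<Longrightarrow> q a \<bullet> q b \<le> 0"
begin

definition adj :: "real^'n \<Rightarrow> real^'n \<Rightarrow> bool" where
  "adj a b \<longleftrightarrow> a \<in> V \<and> b \<in> V \<and> a \<noteq> b \<and> q a \<bullet> q b < 0"

lemma adj_sym: "adj a b \<Longrightarrow> adj b a"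
  by (auto simp: adj_def inner_commute)

lemma finite_V: "finite V"
  using card_V card.infinite by fastforce

lemma dual: "a \<in> V \<Longrightarrow> b \<in> V \<Longrightarrow> c \<in> V \<Longrightarrow> q a \<bullet> (b - c) = of_bool (a = b) - of_bool (a = c)"
  using barycentric_gradientsD[OF bary, of a b c] by simp

lemma gradient_eq:
  assumes "a \<in> V"
  shows "q a = (\<Sum>b\<in>V - {a}. - (q b \<bullet> q a) *\<^sub>R (a - b))"
proof -
  have "q a = (\<Sum>b\<in>V. (q b \<bullet> q a) *\<^sub>R (b - a))"
    using barycentric_gradients_expansion[OF bary _ assms] card_V by simp
  also have "\<dots> = (\<Sum>b\<in>V - {a}. (q b \<bullet> q a) *\<^sub>R (b - a))"
    using assms finite_V by (simp add: sum.remove)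
  also have "\<dots> = (\<Sum>b\<in>V - {a}. - (q b \<bullet> q a) *\<^sub>R (a - b))"
    by (intro sum.cong) (simp_all add: algebra_simps)
  finally show ?thesis .
qed

lemma gradient_coord:
  "a \<in> V \<Longrightarrow> q a $ k = (\<Sum>b\<in>V - {a}. - (q b \<bullet> q a) * (a $ k - b $ k))"
  by (subst gradient_eq) simp_all

text \<open>At a coordinate where \<open>a\<close> is 0, no difference \<open>a $ k - b $ k\<close>
  is positive, while all weights \<open>- (q b \<bullet> q a)\<close> are nonnegative.\<close>

lemma gradient_pos_imp:
  assumes a: "a \<in> V" and "q a $ k > 0" shows "a $ k = 1"
proof (rule ccontr)
  assume "a $ k \<noteq> 1"
  then have "a $ k = 0" using cube a by blast
  then have "- (q b \<bullet> q a) * (a $ k - b $ k) \<le> 0" if "b \<in> V - {a}" for b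
    using gram_nonpos[of b a] cube[of b k] that a by auto
  then have "q a $ k \<le> 0" unfolding gradient_coord[OF a] by (rule sum_nonpos)
  then show False using assms by simp
qed

lemma gradient_neg_imp:
  assumes a: "a \<in> V" and "q a $ k < 0" shows "a $ k = 0"
proof (rule ccontr)
  assume "a $ k \<noteq> 0"
  then have "a $ k = 1" using cube a by blast
  then have "- (q b \<bullet> q a) * (a $ k - b $ k) \<ge> 0" if "b \<in> V - {a}" for b
    using gram_nonpos[of b a] cube[of b k] that a by auto
  then have "q a $ k \<ge> 0" unfolding gradient_coord[OF a] by (rule sum_nonneg)
  then show False using assms by simp
qed

text \<open>All summands of \<open>gradient_coord\<close> have the same weak sign, dictated by
  \<open>a $ k\<close>, so the sum vanishes only termwise; a nonzero weight means adjacency.\<close>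

lemma gradient_zero_iff:
  assumes a: "a \<in> V" 
  shows "q a $ k = 0 \<longleftrightarrow> (\<forall>b. adj a b \<longrightarrow> b $ k = a $ k)"
proof
  let ?t = "\<lambda>b. - (q b \<bullet> q a) * (a $ k - b $ k)"
  assume "q a $ k = 0"
  then have s: "(\<Sum>b\<in>V - {a}. ?t b) = 0" using gradient_coord[OF a] by simp
  have fin: "finite (V - {a})" using finite_V by simp
  have "?t b = 0" if b: "b \<in> V - {a}" for b
  proof (cases "a $ k = 0")
    case True
    have "?t c \<le> 0" if "c \<in> V - {a}" for c
      using gram_nonpos[of c a] cube[of c k] that a True by auto
    then have "\<forall>c\<in>V - {a}. - ?t c = 0"
      using sum_nonneg_eq_0_iff[OF fin, of "\<lambda>c. - ?t c"] s unfolding sum_negf by auto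
    then show ?thesis using b by simp
  next
    case False
    then have 1: "a $ k = 1" using cube a by blast
    have "?t c \<ge> 0" if "c \<in> V - {a}" for c
      using gram_nonpos[of c a] cube[of c k] that a 1 by auto
    then show ?thesis using sum_nonneg_eq_0_iff[OF fin, of ?t] s b by blast
  qed
  then show "\<forall>b. adj a b \<longrightarrow> b $ k = a $ k"
    by (fastforce simp: adj_def inner_commute)
next
  assume *: "\<forall>b. adj a b \<longrightarrow> b $ k = a $ k"
  have "- (q b \<bullet> q a) * (a $ k - b $ k) = 0" if "b \<in> V - {a}" for b
    using * gram_nonpos[of a b] that a by (force simp: adj_def inner_commute)
  then show "q a $ k = 0" unfolding gradient_coord[OF a] by (rule sum.neutral[rule_format])
qed

text \<open>With no edge leaving \<open>W\<close>, the sum \<open>s\<close> of the gradients over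
  \<open>W\<close> is orthogonal to the sum over the complement. The latter is \<open>- s\<close>,
  so \<open>s = 0\<close>; but \<open>s\<close> separates \<open>a\<close> from
  \<open>c\<close>.\<close>

lemma adjacency_connected:
  assumes W: "W \<subseteq> V" "a \<in> W" "c \<in> V" "c \<notin> W"
  shows "\<exists>x\<in>W. \<exists>y\<in>V - W. adj x y"
proof (rule ccontr)
  assume "\<not> ?thesis"
  then have 0: "q x \<bullet> q y = 0" if "x \<in> W" "y \<in> V - W" for x y
    using that W gram_nonpos[of x y] by (fastforce simp: adj_def)
  have fin: "finite W" using W finite_V finite_subset by blast
  define s where "s = (\<Sum>x\<in>W. q x)"
  have "s + (\<Sum>y\<in>V - W. q y) = 0"
    using barycentric_gradients_sum[OF bary] card_V sum.subset_diff[OF W(1) finite_V, of q]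
    by (simp add: s_def add.commute)
  then have "s \<bullet> s = - (s \<bullet> (\<Sum>y\<in>V - W. q y))"
    by (metis add_eq_0_iff inner_minus_right minus_minus)
  also have "\<dots> = 0"
    using 0 by (simp add: s_def inner_sum_left inner_sum_right)
  finally have "s = 0" by simp
  moreover have "s \<bullet> (a - c) = 1"
  proof -
    have "s \<bullet> (a - c) = (\<Sum>x\<in>W. of_bool (x = a))"
      unfolding s_def inner_sum_left using W dual[of _ a c]
      by (intro sum.cong) (auto simp: subset_iff)
    then show ?thesis using fin W by (simp add: of_bool_def)
  qed
  ultimately show False by simp
qed

lemma gradient_nonzero:
  assumes "a \<in> V" shows "q a \<noteq> 0"
proof -
  have "V \<noteq> {a}" using card_V by auto
  then obtain c where "c \<in> V" "c \<noteq> a" using assms by blast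
  then show ?thesis using dual[of a a c] assms by auto
qed

text \<open>If the foot of the altitude from \<open>p\<close> were a vertex of the opposite facet, the whole facet
  would agree with that vertex on the support of the normal.\<close>

lemma apex_on_normal_kernel:
  assumes p: "p \<in> V"
    and star: "\<And>x y. x \<in> V - {p} \<Longrightarrow> y \<in> V - {p} \<Longrightarrow> x \<noteq> y
        \<Longrightarrow> (\<And>k. q p $ k = 0 \<Longrightarrow> x $ k = y $ k) \<Longrightarrow> (\<And>k. q p $ k = 0 \<Longrightarrow> x $ k = v $ k)"
    and interior: "\<And>k. \<exists>x\<in>V - {p}. \<exists>y\<in>V - {p}. x $ k \<noteq> y $ k"
    and k: "q p $ k = 0"
  shows "p $ k = v $ k"
proof -
  obtain l where l: "q p $ l \<noteq> 0"
    using gradient_nonzero[OF p] by (auto simp: Finite_Cartesian_Product.vec_eq_iff)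
  then obtain x where x: "adj p x" using gradient_zero_iff[OF p, of l] by blast
  then have xV: "x \<in> V - {p}" by (auto simp: adj_def)
  have agree: "y $ j = p $ j" if "adj p y" "q p $ j = 0" for y j
    using gradient_zero_iff[OF p] that by blast
  have "\<exists>y. adj p y \<and> y \<noteq> x"
  proof (rule ccontr)
    assume "\<not> ?thesis"
    then have "q b \<bullet> q p = 0" if "b \<in> V - {p} - {x}" for b
      using gram_nonpos[of b p] p that by (force simp: adj_def inner_commute)
    then have "(\<Sum>b\<in>V - {p} - {x}. - (q b \<bullet> q p) *\<^sub>R (p - b)) = 0"
      by (intro sum.neutral) simp
    \<comment> \<open>With a single neighbour \<open>x\<close>, the normal is a positive multiple of
      the edge vector \<open>p - x\<close>.\<close>
    then have qp: "q p = - (q x \<bullet> q p) *\<^sub>R (p - x)"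
      using gradient_eq[OF p] xV finite_V sum.remove[of "V - {p}" x "\<lambda>b. - (q b \<bullet> q p) *\<^sub>R (p - b)"]
      by simp
    have coeff: "q x \<bullet> q p < 0" using x by (simp add: adj_def inner_commute)
    have "y $ l = x $ l" if y: "y \<in> V - {p}" for y
    proof -
      have "q p \<bullet> (y - x) = 0" using dual[of p y x] y xV p by auto
      then have "(q x \<bullet> q p) * ((p - x) \<bullet> (y - x)) = 0" by (subst (asm) qp) simp
      then have "(p - x) \<bullet> (y - x) = 0" using coeff by simp
      then have "(\<Sum>i\<in>UNIV. (p $ i - x $ i) * (y $ i - x $ i)) = 0"
        by (simp add: inner_vec_def)
      \<comment> \<open>At 0/1 points, \<open>p - x\<close> and \<open>y - x\<close> never have
        opposite signs in a coordinate, so their orthogonality holds coordinatewise. Thus every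
        vertex \<open>y\<close> of the facet agrees with \<open>x\<close> at
        \<open>l\<close>.\<close>
      moreover have "(p $ i - x $ i) * (y $ i - x $ i) \<ge> 0" for i
        using cube[of p i] cube[of x i] cube[of y i] p xV y by auto
      ultimately have "(p $ l - x $ l) * (y $ l - x $ l) = 0"
        using sum_nonneg_eq_0_iff[of UNIV "\<lambda>i. (p $ i - x $ i) * (y $ i - x $ i)"] by simp
      moreover have "p $ l \<noteq> x $ l" using l by (subst (asm) qp) auto
      ultimately show ?thesis by simp
    qed
    then show False using interior[of l] by auto
  qed
  then obtain y where y: "adj p y" "y \<noteq> x" by blast
  then have "y \<in> V - {p}" by (auto simp: adj_def)
  \<comment> \<open>Two distinct neighbours of \<open>p\<close> both agree with \<open>p\<close>,
    hence with each other, wherever \<open>q p\<close> vanishes, so \<open>star\<close> applies to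
    them.\<close>
  then have "x $ k = v $ k"
    using star[OF xV, of y k] y agree x k by force
  then show ?thesis using agree[OF x k] by simp
qed

end

text \<open>\<open>w\<close> is the origin of the matrix representation; \<open>bl\<close> and \<open>rho\<close> give the number (from \<open>1\<close>) of the
  diagonal block containing the column of a vertex and the row of a coordinate.\<close>

locale block_triangular_vertices = nonobtuse_vertices V q
  for V :: "(real^'n) set" and q +
  fixes w :: "real^'n" and bl :: "real^'n \<Rightarrow> nat" and rho :: "'n \<Rightarrow> nat"
  assumes w: "w \<in> V" "bl w = 0"
    and bl_pos: "\<And>u. u \<in> V \<Longrightarrow> u \<noteq> w \<Longrightarrow> bl u > 0"
    and triangular: "\<And>u k. u \<in> V \<Longrightarrow> bl u < rho k \<Longrightarrow> u $ k = w $ k"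
    and card_block: "\<And>m. card {u \<in> V. u \<noteq> w \<and> bl u < m} = card {k. rho k < m}"
begin

text \<open>The edge vectors from \<open>w\<close> to the vertices of earlier blocks are supported
  on the coordinates of these blocks. By \<open>card_block\<close> there are as many of them as such
  coordinates; being independent, they span that coordinate subspace. The gradient of a later vertex
  is orthogonal to all of them.\<close>

lemma gradient_zero_before_block:
  assumes u: "u \<in> V" and k: "rho k < bl u"
  shows "q u $ k = 0"
proof -
  let ?m = "bl u"
  let ?B = "(\<lambda>x. x - w) ` {x \<in> V. x \<noteq> w \<and> bl x < ?m}"
  let ?X = "{x::real^'n. \<forall>i. i \<notin> {k. rho k < ?m} \<longrightarrow> x $ i = 0}"
  have aff: "\<not> affine_dependent V"
    using barycentric_gradients_affine_independent[OF bary finite_V] by simp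
  have "independent ((\<lambda>x. x - w) ` (V - {w}))"
    using independent_vertex_differences[OF aff _ w(1)] card_V by simp
  then have ind: "independent ?B"
    by (rule independent_mono) auto
  have "?B \<subseteq> ?X" using triangular by (auto simp: not_less)
  moreover have "dim ?X = card ?B"
  proof -
    have "card ?B = card {x \<in> V. x \<noteq> w \<and> bl x < ?m}"
      by (rule card_image) (simp add: inj_on_def)
    then show ?thesis
      using dim_substandard_cart[of "{k. rho k < ?m}", where 'a=real] card_block by (simp add: dim_vec_eq)
  qed
  ultimately have "?X \<subseteq> span ?B" using card_ge_dim_independent[OF _ ind] by simp
  moreover have "axis k 1 \<in> ?X" using k by (auto simp: axis_def)
  ultimately have "axis k 1 \<in> span ?B" by blast
  moreover have "real_inner_class.orthogonal (q u) y" if "y \<in> ?B" for y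
    using that dual[OF u _ w(1)] k w by (auto simp: real_inner_class.orthogonal_def)
  ultimately have "real_inner_class.orthogonal (q u) (axis k 1)"
    using orthogonal_to_span by blast
  then show ?thesis by (simp add: real_inner_class.orthogonal_def inner_axis)
qed

text \<open>Before the later block, the gradient of an endpoint in that block vanishes, which forces
  its neighbours to agree with it. After that block both endpoints coincide with
  \<open>w\<close>.\<close>

lemma adj_agree_off_block:
  assumes ab: "adj a b" and k: "rho k \<noteq> max (bl a) (bl b)"
  shows "a $ k = b $ k"
proof -
  have *: "a $ k = b $ k" if "adj a b" "bl a \<le> bl b" "rho k \<noteq> bl b" for a b
  proof (cases "rho k < bl b")
    case True
    then show ?thesis
      using gradient_zero_iff[of b k] gradient_zero_before_block[of b k] adj_sym that
      by (metis adj_def)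
  next
    case False
    then show ?thesis using triangular[of a k] triangular[of b k] that by (auto simp: adj_def)
  qed
  then show ?thesis
    using *[of a b] *[of b a] adj_sym[OF ab] ab k by (auto simp: max_def split: if_splits)
qed

text \<open>The projection stays in the ambient type; \<open>bpart m x \<bullet> y\<close> serves as
  the inner product of the \<open>m\<close>-th component.\<close>

definition bpart :: "nat \<Rightarrow> real^'n \<Rightarrow> real^'n" where
  "bpart m x = (\<chi> k. if rho k = m then x $ k else 0)"

lemma bpart_zero:
  "(\<And>k. rho k = m \<Longrightarrow> y $ k = 0) \<Longrightarrow> bpart m x \<bullet> y = 0"
  unfolding inner_vec_def bpart_def by (intro sum.neutral) auto

lemma bpart_sum: "bpart m (\<Sum>i\<in>I. f i) = (\<Sum>i\<in>I. bpart m (f i))"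
  by (auto simp: bpart_def Finite_Cartesian_Product.vec_eq_iff)

text \<open>\<open>q a\<close> vanishes before block \<open>m\<close> and \<open>b - w\<close> after
  it, so the projection loses nothing: the projected gradients are dual to the edge vectors of the
  component.\<close>

lemma bpart_dual:
  assumes "a \<in> V" "b \<in> V" "bl a = m" "bl b \<le> m" "m > 0"
  shows "bpart m (q a) \<bullet> (b - w) = of_bool (a = b)"
proof -
  have "bpart m (q a) \<bullet> (b - w) = q a \<bullet> (b - w)"
    unfolding inner_vec_def
  proof (intro sum.cong refl)
    fix k
    consider "rho k < m" | "rho k = m" | "rho k > m" by linarith
    then show "bpart m (q a) $ k \<bullet> (b - w) $ k = q a $ k \<bullet> (b - w) $ k"
      using gradient_zero_before_block[of a k] triangular[of b k] assms
      by cases (auto simp: bpart_def)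
  qed
  then show ?thesis using dual[OF assms(1,2) w(1)] assms w by auto
qed

lemma bpart_adj_later:
  assumes "adj a b" "bl a = m" "bl b > m"
  shows "bpart m y \<bullet> (a - b) = 0"
  using assms adj_agree_off_block[OF assms(1)] by (intro bpart_zero) auto

text \<open>In the expansion of \<open>q a\<close> by \<open>gradient_eq\<close>, a vertex
  \<open>b\<close> of a later block contributes nothing: either its weight is 0 or the edge changes
  no coordinate of block \<open>m\<close>.\<close>

lemma bpart_gram:
  assumes a: "a \<in> V" "bl a = m" and y: "\<And>b. b \<in> V \<Longrightarrow> b \<noteq> a \<Longrightarrow> bl b \<le> m \<Longrightarrow> bpart m y \<bullet> (a - b) = h b"
  shows "bpart m y \<bullet> q a = (\<Sum>b | b \<in> V \<and> b \<noteq> a \<and> bl b \<le> m. - (q b \<bullet> q a) * h b)"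
proof -
  have "bpart m y \<bullet> q a = (\<Sum>b\<in>V - {a}. - (q b \<bullet> q a) * (bpart m y \<bullet> (a - b)))"
    by (subst gradient_eq[OF a(1)]) (simp add: inner_sum_right sum_negf)
  also have "\<dots> = (\<Sum>b | b \<in> V \<and> b \<noteq> a \<and> bl b \<le> m. - (q b \<bullet> q a) * h b)"
  proof (rule sum.mono_neutral_cong_right)
    show "\<forall>i\<in>V - {a} - {b. b \<in> V \<and> b \<noteq> a \<and> bl b \<le> m}. - (q i \<bullet> q a) * (bpart m y \<bullet> (a - i)) = 0"
    proof
      fix b assume b: "b \<in> V - {a} - {b. b \<in> V \<and> b \<noteq> a \<and> bl b \<le> m}"
      then consider "adj a b" | "q b \<bullet> q a = 0"
        using gram_nonpos[of a b] a by (force simp: adj_def inner_commute)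
      then show "- (q b \<bullet> q a) * (bpart m y \<bullet> (a - b)) = 0"
        using bpart_adj_later[of a b m y] a b by cases auto
    qed
  qed (use finite_V y in auto)
  finally show ?thesis .
qed

text \<open>By \<open>bpart_dual\<close>, only the term for \<open>b = c\<close> of
  \<open>bpart_gram\<close> survives. This transfers acuteness of a component to the gradients of
  the whole simplex.\<close>

lemma bpart_gram_same_block:
  assumes "a \<in> V" "c \<in> V" "bl a = m" "bl c = m" "m > 0" "a \<noteq> c"
  shows "bpart m (q c) \<bullet> q a = q c \<bullet> q a"
proof -
  have "bpart m (q c) \<bullet> q a = (\<Sum>b | b \<in> V \<and> b \<noteq> a \<and> bl b \<le> m. - (q b \<bullet> q a) * - of_bool (c = b))"
  proof (rule bpart_gram)
    fix b assume b: "b \<in> V" "b \<noteq> a" "bl b \<le> m"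
    have "bpart m (q c) \<bullet> (a - b) = bpart m (q c) \<bullet> (a - w) - bpart m (q c) \<bullet> (b - w)"
      by (simp add: inner_diff_right)
    then show "bpart m (q c) \<bullet> (a - b) = - of_bool (c = b)"
      using bpart_dual[of c a m] bpart_dual[of c b m] assms b by simp
  qed (use assms in auto)
  also have "\<dots> = (\<Sum>b | b \<in> V \<and> b \<noteq> a \<and> bl b \<le> m. if c = b then q b \<bullet> q a else 0)"
    by (intro sum.cong) auto
  also have "\<dots> = q c \<bullet> q a"
    using finite_V assms by simp
  finally show ?thesis .
qed

text \<open>Measured from \<open>w\<close>, the block sum takes the value 1 on the vertices of block
  \<open>m\<close> and 0 on earlier ones, so it is minus the gradient at the base vertex of the
  component. What remains is the total weight of the edges from \<open>a\<close> to earlier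
  blocks.\<close>

lemma bpart_gram_block_sum:
  assumes "a \<in> V" "bl a = m" "m > 0"
  shows "bpart m (\<Sum>c | c \<in> V \<and> bl c = m. q c) \<bullet> q a = (\<Sum>b | b \<in> V \<and> bl b < m. - (q b \<bullet> q a))"
proof -
  let ?J = "{c \<in> V. bl c = m}"
  have fin: "finite ?J" using finite_V by simp
  have s: "bpart m (\<Sum>c\<in>?J. q c) \<bullet> (b - w) = of_bool (bl b = m)" if "b \<in> V" "bl b \<le> m" for b
  proof -
    have "bpart m (\<Sum>c\<in>?J. q c) \<bullet> (b - w) = (\<Sum>c\<in>?J. if c = b then 1 else 0)"
      unfolding bpart_sum inner_sum_left using that assms
      by (intro sum.cong) (auto simp: bpart_dual)
    then show ?thesis using fin that by auto
  qed
  have "bpart m (\<Sum>c\<in>?J. q c) \<bullet> q a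
      = (\<Sum>b | b \<in> V \<and> b \<noteq> a \<and> bl b \<le> m. - (q b \<bullet> q a) * (1 - of_bool (bl b = m)))"
  proof (rule bpart_gram)
    fix b assume b: "b \<in> V" "b \<noteq> a" "bl b \<le> m"
    have "bpart m (\<Sum>c\<in>?J. q c) \<bullet> (a - b)
        = bpart m (\<Sum>c\<in>?J. q c) \<bullet> (a - w) - bpart m (\<Sum>c\<in>?J. q c) \<bullet> (b - w)"
      by (simp add: inner_diff_right)
    then show "bpart m (\<Sum>c\<in>?J. q c) \<bullet> (a - b) = 1 - of_bool (bl b = m)"
      using s[of a] s[of b] assms b by simp
  qed (use assms in auto)
  also have "\<dots> = (\<Sum>b | b \<in> V \<and> bl b < m. - (q b \<bullet> q a))"
    using finite_V assms by (intro sum.mono_neutral_cong_right) auto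
  finally show ?thesis .
qed

end

text \<open>Both assumptions express acuteness of the components: inner products are negative
  between two gradients of a block, and between one of them and the gradient at the base vertex,
  which is minus the block sum.\<close>

locale acute_block_vertices = block_triangular_vertices V q w bl rho
  for V :: "(real^'n) set" and q w bl rho +
  assumes acute_block: "\<And>a c. a \<in> V \<Longrightarrow> c \<in> V \<Longrightarrow> bl a = bl c \<Longrightarrow> bl a > 0 \<Longrightarrow> a \<noteq> c
      \<Longrightarrow> bpart (bl a) (q c) \<bullet> q a < 0"
    and acute_block_base: "\<And>a. a \<in> V \<Longrightarrow> bl a > 0
      \<Longrightarrow> bpart (bl a) (\<Sum>c | c \<in> V \<and> bl c = bl a. q c) \<bullet> q a > 0"
begin

lemma adj_same_block:
  "a \<in> V \<Longrightarrow> c \<in> V \<Longrightarrow> bl a = bl c \<Longrightarrow> bl a > 0 \<Longrightarrow> a \<noteq> c \<Longrightarrow> adj a c"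
  unfolding adj_def using acute_block bpart_gram_same_block by metis

lemma adj_earlier_block:
  assumes "a \<in> V" "bl a > 0"
  obtains b where "adj a b" "bl b < bl a"
proof -
  have "\<exists>b\<in>{b \<in> V. bl b < bl a}. q b \<bullet> q a < 0"
  proof (rule ccontr)
    assume "\<not> ?thesis"
    then have "(\<Sum>b | b \<in> V \<and> bl b < bl a. - (q b \<bullet> q a)) \<le> 0"
      by (intro sum_nonpos) (auto simp: not_less)
    then show False
      using acute_block_base[OF assms] bpart_gram_block_sum[OF assms(1) refl assms(2)] by simp
  qed
  then show ?thesis using that assms by (auto simp: adj_def inner_commute)
qed

text \<open>The edges involved change no coordinate before block \<open>m\<close>, so
  \<open>u\<close>, \<open>j\<close>, \<open>j'\<close> and \<open>u'\<close> all agree there; from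
  block \<open>m\<close> on, \<open>u\<close> and \<open>u'\<close> coincide with \<open>w\<close>.
  Hence a block is attached to the earlier ones at a single vertex.\<close>

lemma earlier_neighbour_unique:
  assumes "adj j u" "adj j' u'" "bl j = m" "bl j' = m" "bl u < m" "bl u' < m"
  shows "u = u'"
proof -
  have "u $ k = u' $ k" for k
  proof (cases "rho k < m")
    case True
    have "u $ k = j $ k" using adj_agree_off_block[OF assms(1), of k] assms True by auto
    also have "j $ k = j' $ k"
      using adj_same_block[of j j'] adj_agree_off_block[of j j' k] assms True
      by (cases "j = j'") (auto simp: adj_def)
    also have "j' $ k = u' $ k" using adj_agree_off_block[OF assms(2), of k] assms True by auto
    finally show ?thesis .
  next
    case False
    then show ?thesis using triangular[of u k] triangular[of u' k] assms by (auto simp: adj_def)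
  qed
  then show ?thesis by (simp add: Finite_Cartesian_Product.vec_eq_iff)
qed

text \<open>An edge belongs to the block of its later endpoint, the only block whose coordinates it
  changes.\<close>

definition members :: "nat \<Rightarrow> (real^'n) set" where
  "members m = {a. \<exists>b. adj a b \<and> max (bl a) (bl b) = m}"

text \<open>The members are vertices of block \<open>m\<close> and at most one earlier vertex. The
  former are pairwise adjacent by acuteness, and each has an earlier neighbour, which can only be
  the latter.\<close>

lemma members_clique:
  assumes y: "y \<in> members m" and z: "z \<in> members m" and "y \<noteq> z"
  shows "adj y z"
proof -
  obtain y' z' where y': "adj y y'" "max (bl y) (bl y') = m" and z': "adj z z'" "max (bl z) (bl z') = m"
    using y z by (auto simp: members_def)
  have "m > 0"
    using y' bl_pos[of y] bl_pos[of y'] unfolding adj_def by (metis less_max_iff_disj)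
  have *: "adj j z" if j: "j \<in> V" "bl j = m" and z: "bl z < m" and z': "adj z z'" "bl z' = m" for j z z'
  proof -
    obtain u where u: "adj j u" "bl u < bl j" using adj_earlier_block[of j] j \<open>m > 0\<close> by auto
    then have "u = z" using earlier_neighbour_unique[of j u z' z m] adj_sym[OF z'(1)] that by auto
    then show ?thesis using u by simp
  qed
  consider "bl y = m" "bl z = m" | "bl y = m" "bl z < m" | "bl y < m" "bl z = m" | "bl y < m" "bl z < m"
    using y' z' by linarith
  then show ?thesis
  proof cases
    case 1
    then show ?thesis using adj_same_block[of y z] y' z' \<open>m > 0\<close> assms by (auto simp: adj_def)
  next
    case 2
    then have "bl z' = m" using z' by linarith
    then show ?thesis using *[of y z z'] 2 y' z' by (simp add: adj_def)
  next
    case 3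
    then have "bl y' = m" using y' by linarith
    then have "adj z y" using *[of z y y'] 3 y' z' by (simp add: adj_def)
    then show ?thesis by (rule adj_sym)
  next
    case 4
    then have "bl y' = m" "bl z' = m" using y' z' by linarith+
    then have "y = z"
      using earlier_neighbour_unique[OF adj_sym[OF y'(1)] adj_sym[OF z'(1)]] 4 by blast
    then show ?thesis using assms by simp
  qed
qed

lemma adj_imp_member:
  assumes "adj a b" "a $ k \<noteq> b $ k"
  shows "a \<in> members (rho k)"
  using adj_agree_off_block[OF assms(1), of k] assms unfolding members_def by force

text \<open>Deleting the vertices that agree with \<open>v\<close> in a coordinate \<open>k\<close> where \<open>q v\<close> vanishes leaves a
  connected graph, since all edges changing that coordinate lie in a single clique. If \<open>x\<close> and \<open>y\<close>
  disagreed with \<open>v\<close> there, a remaining edge would change some coordinate in which \<open>x\<close> and \<open>y\<close> differ.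
  That edge lies in a clique containing \<open>v\<close>, so \<open>v\<close> would have a neighbour disagreeing with it in \<open>k\<close>.\<close>

lemma agree_on_gradient_kernel:
  assumes v: "v \<in> V" and x: "x \<in> V" and y: "y \<in> V" and xy: "x \<noteq> y"
    and agree: "\<And>k. q v $ k = 0 \<Longrightarrow> x $ k = y $ k"
    and k: "q v $ k = 0"
  shows "x $ k = v $ k"
proof (rule ccontr)
  assume xk: "x $ k \<noteq> v $ k"
  obtain l where l: "x $ l \<noteq> y $ l" using xy by (auto simp: Finite_Cartesian_Product.vec_eq_iff)
  then have ql: "q v $ l \<noteq> 0" using agree by blast
  let ?W = "\<lambda>z. {u \<in> V. u $ k \<noteq> v $ k \<and> u $ l = z $ l}"
  have "\<exists>a b. adj a b \<and> a \<in> ?W x \<and> b \<in> ?W y"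
  proof (rule ccontr)
    assume none: "\<nexists>a b. adj a b \<and> a \<in> ?W x \<and> b \<in> ?W y"
    \<comment> \<open>An edge leaving \<open>?W z\<close> cannot end in \<open>?W z'\<close>. As
      coordinates are 0 or 1, its far end then agrees with \<open>v\<close> at \<open>k\<close>, so
      it is an edge of block \<open>rho k\<close>.\<close>
    have leave: "\<exists>a\<in>?W z. a \<in> members (rho k)"
      if z: "z = x \<and> z' = y \<or> z = y \<and> z' = x" for z z'
    proof -
      have "z \<in> ?W z" using z x y xk agree[OF k] by auto
      then obtain a b where ab: "a \<in> ?W z" "b \<in> V - ?W z" "adj a b"
        using adjacency_connected[of "?W z" z v] v by blast
      have "b $ l = z $ l \<or> b $ l = z' $ l"
        using cube[of b l] cube[of x l] cube[of y l] z l ab x y by auto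
      moreover have "b \<notin> ?W z'" using none ab adj_sym z by blast
      ultimately have "b $ k = v $ k" using ab by auto
      then show ?thesis using adj_imp_member[OF ab(3), of k] ab by auto
    qed
    \<comment> \<open>Both halves meet the clique of block \<open>rho k\<close>, whose members are
      adjacent, against \<open>none\<close>.\<close>
    obtain a b where "a \<in> ?W x" "b \<in> ?W y" "a \<in> members (rho k)" "b \<in> members (rho k)"
      using leave[of x y] leave[of y x] by blast
    moreover from this have "a \<noteq> b" using l by auto
    ultimately show False using members_clique none by blast
  qed
  then obtain a b where ab: "adj a b" "a $ k \<noteq> v $ k" "a $ l \<noteq> b $ l" using l by auto
  then have "a \<in> members (rho l)" using adj_imp_member by blast
  \<comment> \<open>Some edge at \<open>v\<close> changes coordinate \<open>l\<close>, because
    \<open>q v $ l\<close> is nonzero.\<close>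
  moreover have "v \<in> members (rho l)"
    using ql gradient_zero_iff[OF v, of l] adj_imp_member[of v _ l] by metis
  ultimately have "adj v a" using members_clique[of v "rho l" a] ab by auto
  then show False using gradient_zero_iff[OF v, of k] k ab by blast
qed

end

section \<open>Acute components\<close>

context block_triangular_vertices
begin

text \<open>\<open>\<psi>\<close> maps the block coordinates isometrically and kills the others. The
  images of the block gradients, with minus their sum at the base vertex, are the barycentric
  gradients of the component, so \<open>acute_gradients\<close> applies.\<close>

lemma
  fixes \<psi> :: "real^'n \<Rightarrow> 'b::euclidean_space"
  assumes lin: "linear \<psi>" and iso: "\<And>x y. \<psi> x \<bullet> \<psi> y = bpart m x \<bullet> y" and m: "m > 0"
    and acute: "acute (convex hull ((\<lambda>u. \<psi> (u - w)) ` insert w {u \<in> V. bl u = m}))"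
    and a: "a \<in> V" "bl a = m"
  shows acute_component_block: "c \<in> V \<Longrightarrow> bl c = m \<Longrightarrow> a \<noteq> c \<Longrightarrow> bpart m (q c) \<bullet> q a < 0"
    and acute_component_base: "bpart m (\<Sum>c | c \<in> V \<and> bl c = m. q c) \<bullet> q a > 0"
proof -
  define J where "J = {u \<in> V. bl u = m}"
  define I where "I = insert w J"
  define f where "f = (\<lambda>u. \<psi> (u - w))"
  define g where "g = (\<lambda>u. if u = w then \<psi> (- (\<Sum>c\<in>J. q c)) else \<psi> (q u))"
  have finJ: "finite J" using finite_V by (simp add: J_def)
  have wJ: "w \<notin> J" using w m by (simp add: J_def)
  have IV: "b \<in> V" "bl b \<le> m" if "b \<in> I" for b using that w by (auto simp: I_def J_def)
  have diff: "f b - f c = \<psi> (b - c)" for b c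
    unfolding f_def by (simp add: linear_diff[OF lin])
  have iso_dual: "\<psi> (q a) \<bullet> \<psi> (b - c) = of_bool (a = b) - of_bool (a = c)"
    if "a \<in> J" "b \<in> I" "c \<in> I" for a b c
  proof -
    have "\<psi> (q a) \<bullet> \<psi> (b - c) = bpart m (q a) \<bullet> (b - w) - bpart m (q a) \<bullet> (c - w)"
      by (simp add: iso inner_diff_right)
    then show ?thesis
      using bpart_dual[of a b m] bpart_dual[of a c m] IV that m by (simp add: J_def)
  qed
  have bg: "barycentric_gradients I f g"
    unfolding barycentric_gradients_def
  proof (intro ballI)
    fix a b c assume abc: "a \<in> I" "b \<in> I" "c \<in> I"
    show "g a \<bullet> (f b - f c) = of_bool (a = b) - of_bool (a = c)"
    proof (cases "a = w")
      case True
      have ind: "(\<Sum>a\<in>J. of_bool (a = b)) = (1 - of_bool (w = b) :: real)" if "b \<in> I" for b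
        using that finJ wJ by (auto simp: I_def of_bool_def)
      have "g a \<bullet> (f b - f c) = - (\<Sum>a\<in>J. \<psi> (q a) \<bullet> \<psi> (b - c))"
        using True by (simp add: g_def diff linear_neg[OF lin] linear_sum[OF lin] inner_sum_left)
      also have "\<dots> = - (\<Sum>a\<in>J. of_bool (a = b) - of_bool (a = c))"
        using iso_dual abc by simp
      also have "\<dots> = of_bool (a = b) - of_bool (a = c)"
        using abc ind True by (simp add: sum_subtractf)
      finally show ?thesis .
    next
      case False
      then show ?thesis using iso_dual abc by (simp add: g_def diff I_def)
    qed
  qed
  let ?D = "{f b - f c | b c. b \<in> I \<and> c \<in> I}"
  \<comment> \<open>In the expansion of \<open>q a\<close>, edges within the block become
    differences of component vertices, edges to earlier blocks become edges to the base vertex, and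
    edges to later blocks are mapped to 0.\<close>
  have spanJ: "\<psi> (q a) \<in> span ?D" if a: "a \<in> J" for a
  proof -
    have aV: "a \<in> V" "bl a = m" using a by (auto simp: J_def)
    have "(q b \<bullet> q a) *\<^sub>R \<psi> (a - b) \<in> span ?D" if b: "b \<in> V" "b \<noteq> a" for b
    proof -
      consider "bl b = m" | "bl b < m" | "bl b > m" "adj a b" | "q b \<bullet> q a = 0"
        using gram_nonpos[OF b(1) aV(1) b(2)] b aV inner_commute[of "q a" "q b"]
        unfolding adj_def by (metis linorder_neqE_nat order_le_less)
      then show ?thesis
      proof cases
        case 1
        then have "a \<in> I" "b \<in> I" using a b by (simp_all add: I_def J_def)
        then have "\<psi> (a - b) \<in> ?D" unfolding diff[symmetric] by blast
        then show ?thesis by (intro span_mul span_base)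
      next
        case 2
        have "bpart m (b - w) \<bullet> (b - w) = 0"
          using triangular[OF b(1)] 2 by (intro bpart_zero) simp
        then have "\<psi> (b - w) = 0" using iso[of "b - w" "b - w"] by simp
        then have "\<psi> (a - b) = f a - f w"
          using diff[of a b] linear_0[OF lin] by (simp add: f_def)
        then have "\<psi> (a - b) \<in> ?D" using a by (auto simp: I_def)
        then show ?thesis by (intro span_mul span_base)
      next
        case 3
        then have "\<psi> (a - b) = 0"
          using iso[of "a - b" "a - b"] bpart_adj_later[of a b m "a - b"] aV by simp
        then show ?thesis by (simp add: span_zero)
      next
        case 4
        then show ?thesis by (simp add: span_zero)
      qed
    qed
    then have "(\<Sum>b\<in>V - {a}. - ((q b \<bullet> q a) *\<^sub>R \<psi> (a - b))) \<in> span ?D"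
      by (intro span_sum span_neg) auto
    also have "(\<Sum>b\<in>V - {a}. - ((q b \<bullet> q a) *\<^sub>R \<psi> (a - b))) = \<psi> (q a)"
      using arg_cong[OF gradient_eq[OF aV(1)], of \<psi>]
      by (simp add: linear_sum[OF lin] linear_neg[OF lin] linear_cmul[OF lin])
    finally show ?thesis .
  qed
  have span: "g a \<in> span ?D" if "a \<in> I" for a
  proof (cases "a = w")
    case True
    then show ?thesis
      using spanJ by (auto simp: g_def linear_neg[OF lin] linear_sum[OF lin] intro!: span_neg span_sum)
  next
    case False
    then show ?thesis using that spanJ by (auto simp: g_def I_def)
  qed
  have "acute (convex hull (f ` I))" using acute unfolding I_def J_def f_def .
  then have neg: "g a \<bullet> g b < 0" if "a \<in> I" "b \<in> I" "a \<noteq> b" for a b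
    using acute_gradients[OF bg _ that span] finJ by (simp add: I_def)
  have aw: "a \<in> J" "a \<noteq> w" using a wJ by (auto simp: J_def)
  show "bpart m (q c) \<bullet> q a < 0" if c: "c \<in> V" "bl c = m" "a \<noteq> c"
  proof -
    have "c \<in> J" using c by (simp add: J_def)
    moreover from this have "c \<noteq> w" using wJ by blast
    ultimately show ?thesis using neg[of c a] c aw by (simp add: I_def g_def iso)
  qed
  have "\<psi> (- (\<Sum>c\<in>J. q c)) \<bullet> \<psi> (q a) < 0"
    using neg[of w a] aw by (simp add: I_def g_def)
  then show "bpart m (\<Sum>c | c \<in> V \<and> bl c = m. q c) \<bullet> q a > 0"
    unfolding linear_neg[OF lin] inner_minus_left iso J_def by simp
qed

end

section \<open>Reading the block structure off a matrix representation\<close>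

lemma permutation_matrixE:
  assumes "permutation_matrix m Q"
  obtains \<sigma> where "\<sigma> permutes {..<m}" "Q \<in> carrier_mat m m"
    "\<And>v i. v \<in> carrier_vec m \<Longrightarrow> i < m \<Longrightarrow> vec_index (Q *\<^sub>v v) (\<sigma> i) = vec_index v i"
    "\<And>A i j. A \<in> carrier_mat m m \<Longrightarrow> i < m \<Longrightarrow> j < m \<Longrightarrow> (Q * A) $$ (\<sigma> i, j) = A $$ (i, j)"
    "\<And>A i j. A \<in> carrier_mat m m \<Longrightarrow> i < m \<Longrightarrow> j < m \<Longrightarrow> (A * Q) $$ (i, j) = A $$ (i, \<sigma> j)"
proof -
  obtain \<sigma> where \<sigma>: "\<sigma> permutes {..<m}" and Q: "Q = Matrix.mat m m (\<lambda>(i, j). if i = \<sigma> j then 1 else 0)"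
    using assms by (auto simp: permutation_matrix_def)
  have lt: "\<sigma> i < m" if "i < m" for i using permutes_in_image[OF \<sigma>, of i] that by simp
  have inj: "\<sigma> i = \<sigma> j \<longleftrightarrow> i = j" for i j using permutes_inj[OF \<sigma>] by (auto dest: injD)
  have act: "(\<Sum>l = 0..<m. Q $$ (\<sigma> i, l) * h l) = h i" if "i < m" for h i
  proof -
    have "(\<Sum>l = 0..<m. Q $$ (\<sigma> i, l) * h l) = (\<Sum>l = 0..<m. if i = l then h l else 0)"
      using that lt by (intro sum.cong) (auto simp: Q inj)
    then show ?thesis using that by simp
  qed
  show ?thesis
  proof
    show "\<sigma> permutes {..<m}" by fact
    show "Q \<in> carrier_mat m m" by (simp add: Q)
    fix v :: "real vec" and A :: "real mat" and i j
    show "vec_index (Q *\<^sub>v v) (\<sigma> i) = vec_index v i" if "v \<in> carrier_vec m" "i < m"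
      using that act[of i "vec_index v"] lt by (simp add: scalar_prod_def Q)
    show "(Q * A) $$ (\<sigma> i, j) = A $$ (i, j)" if "A \<in> carrier_mat m m" "i < m" "j < m"
      using that act[of i "\<lambda>l. A $$ (l, j)"] lt by (simp add: scalar_prod_def Q)
    show "(A * Q) $$ (i, j) = A $$ (i, \<sigma> j)" if "A \<in> carrier_mat m m" "i < m" "j < m"
    proof -
      have "(A * Q) $$ (i, j) = (\<Sum>l = 0..<m. if l = \<sigma> j then A $$ (i, l) else 0)"
        using that lt[of j] by (simp add: scalar_prod_def Q if_distrib[of "\<lambda>x. _ * x"] cong: if_cong)
      then show ?thesis using lt that by simp
    qed
  qed
qed

text \<open>\<open>\<beta> i\<close> is the number, from 0, of the diagonal block containing index
  \<open>i\<close>, and \<open>d\<close> is the first index of block \<open>m\<close>. The induction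
  peels off the first block and shifts the remaining indices by its size.\<close>

lemma block_upper_triangular_index:
  assumes "block_upper_triangular As M"
  shows "\<exists>\<beta>. (\<forall>i<dim_row M. \<forall>j<dim_row M. \<beta> j < \<beta> i \<longrightarrow> M $$ (i, j) = 0)
    \<and> (\<forall>i<dim_row M. \<beta> i < length As)
    \<and> (\<forall>m<length As. \<exists>d. {i. i < dim_row M \<and> \<beta> i = m} = {d..<d + dim_row (As ! m)}
        \<and> dim_col (As ! m) = dim_row (As ! m)
        \<and> (\<forall>i<dim_row (As ! m). \<forall>j<dim_row (As ! m). (As ! m) $$ (i, j) = M $$ (d + i, d + j)))"
  using assms
proof (induction As arbitrary: M)
  case Nil
  then show ?case by auto
next
  case (Cons A As)
  then obtain k m B D where *: "A \<in> carrier_mat k k" "B \<in> carrier_mat k m" "D \<in> carrier_mat m m"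
      "block_upper_triangular As D" and M: "M = four_block_mat A B (0\<^sub>m m k) D"
    by auto
  obtain \<beta> where \<beta>0: "\<And>i j. i < m \<Longrightarrow> j < m \<Longrightarrow> \<beta> j < \<beta> i \<Longrightarrow> D $$ (i, j) = 0"
    and \<beta>l: "\<And>i. i < m \<Longrightarrow> \<beta> i < length As"
    and \<beta>b: "\<And>l. l < length As \<Longrightarrow> \<exists>d. {i. i < m \<and> \<beta> i = l} = {d..<d + dim_row (As ! l)}
        \<and> dim_col (As ! l) = dim_row (As ! l)
        \<and> (\<forall>i<dim_row (As ! l). \<forall>j<dim_row (As ! l). (As ! l) $$ (i, j) = D $$ (d + i, d + j))"
    using Cons.IH[OF *(4)] *(3) by auto
  define \<beta>' where "\<beta>' = (\<lambda>i. if i < k then 0 else Suc (\<beta> (i - k)))"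
  have dim: "dim_row M = k + m" using * by (simp add: M)
  have ent: "M $$ (i, j) = (if i < k then if j < k then A $$ (i, j) else B $$ (i, j - k)
      else if j < k then 0 else D $$ (i - k, j - k))" if "i < k + m" "j < k + m" for i j
    using that * by (auto simp: M)
  show ?case
  proof (intro exI[of _ \<beta>'] conjI allI impI)
    show "M $$ (i, j) = 0" if "i < dim_row M" "j < dim_row M" "\<beta>' j < \<beta>' i" for i j
      using that \<beta>0[of "i - k" "j - k"] by (auto simp: ent dim \<beta>'_def split: if_splits)
    show "\<beta>' i < length (A # As)" if "i < dim_row M" for i
      using that \<beta>l[of "i - k"] by (auto simp: dim \<beta>'_def)
    fix l assume l: "l < length (A # As)"
    show "\<exists>d. {i. i < dim_row M \<and> \<beta>' i = l} = {d..<d + dim_row ((A # As) ! l)}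
        \<and> dim_col ((A # As) ! l) = dim_row ((A # As) ! l)
        \<and> (\<forall>i<dim_row ((A # As) ! l). \<forall>j<dim_row ((A # As) ! l).
             ((A # As) ! l) $$ (i, j) = M $$ (d + i, d + j))"
    proof (cases l)
      case 0
      then show ?thesis
        using * by (intro exI[of _ 0]) (auto simp: dim \<beta>'_def ent)
    next
      case (Suc l')
      then obtain d where d: "{i. i < m \<and> \<beta> i = l'} = {d..<d + dim_row (As ! l')}"
          "dim_col (As ! l') = dim_row (As ! l')"
          "\<And>i j. i < dim_row (As ! l') \<Longrightarrow> j < dim_row (As ! l') \<Longrightarrow>
            (As ! l') $$ (i, j) = D $$ (d + i, d + j)"
        using \<beta>b[of l'] l by auto
      have dm: "d + i < m" if "i < dim_row (As ! l')" for i
        using d(1) that by (metis (mono_tags, lifting) atLeastLessThan_iff le_add1 mem_Collect_eq nat_add_left_cancel_less)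
      have "{i. i < dim_row M \<and> \<beta>' i = l} = (\<lambda>i. k + i) ` {i. i < m \<and> \<beta> i = l'}"
      proof (intro equalityI subsetI)
        fix i assume "i \<in> {i. i < dim_row M \<and> \<beta>' i = l}"
        then have "i - k \<in> {i. i < m \<and> \<beta> i = l'}" "i = k + (i - k)"
          by (auto simp: dim \<beta>'_def Suc split: if_splits)
        then show "i \<in> (\<lambda>i. k + i) ` {i. i < m \<and> \<beta> i = l'}" by blast
      qed (auto simp: dim \<beta>'_def Suc)
      also have "\<dots> = {k + d..<k + d + dim_row (As ! l')}"
        unfolding d by (simp add: ac_simps)
      finally show ?thesis
        using d dm Suc by (intro exI[of _ "k + d"]) (auto simp: ent add.assoc)
    qed
  qed
qed

text \<open>Row permutations only rename coordinates and column permutations only reorder vertices;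
  \<open>\<kappa>\<close> and \<open>\<tau>\<close> absorb them.\<close>

lemma matrix_representation_entries:
  fixes S :: "(real^'n) set"
  assumes "matrix_representation S P"
    and Q1: "permutation_matrix CARD('n) Q1" and Q2: "permutation_matrix CARD('n) Q2"
  obtains w \<kappa> \<tau> where "w extreme_point_of S"
    "bij_betw \<kappa> {..<CARD('n)} (UNIV :: 'n set)"
    "bij_betw \<tau> {..<CARD('n)} {u. u extreme_point_of S \<and> u \<noteq> w}"
    "Q1 * P * Q2 \<in> carrier_mat CARD('n) CARD('n)"
    "\<And>i j. i < CARD('n) \<Longrightarrow> j < CARD('n) \<Longrightarrow> (Q1 * P * Q2) $$ (i, j) = add_mod2 (\<tau> j) w $ \<kappa> i"
proof -
  let ?n = "CARD('n)"
  let ?e = "from_nat_into (UNIV :: 'n set)"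
  obtain w Q us where P: "P \<in> carrier_mat ?n ?n" and w: "w extreme_point_of S"
    and Q: "permutation_matrix ?n Q" and us: "distinct us" "set us = {u. u extreme_point_of S \<and> u \<noteq> w}"
    and cols: "cols P = map (\<lambda>u. Q *\<^sub>v to_coords (add_mod2 u w)) us"
    using assms(1) unfolding matrix_representation_def by blast
  obtain \<sigma> where \<sigma>: "\<sigma> permutes {..<?n}" "Q \<in> carrier_mat ?n ?n"
      "\<And>v i. v \<in> carrier_vec ?n \<Longrightarrow> i < ?n \<Longrightarrow> vec_index (Q *\<^sub>v v) (\<sigma> i) = vec_index v i"
    using permutation_matrixE[OF Q] by metis
  obtain \<sigma>1 where \<sigma>1: "\<sigma>1 permutes {..<?n}" "Q1 \<in> carrier_mat ?n ?n"
      "\<And>A i j. A \<in> carrier_mat ?n ?n \<Longrightarrow> i < ?n \<Longrightarrow> j < ?n \<Longrightarrow> (Q1 * A) $$ (\<sigma>1 i, j) = A $$ (i, j)"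
    using permutation_matrixE[OF Q1] by metis
  obtain \<sigma>2 where \<sigma>2: "\<sigma>2 permutes {..<?n}" "Q2 \<in> carrier_mat ?n ?n"
      "\<And>A i j. A \<in> carrier_mat ?n ?n \<Longrightarrow> i < ?n \<Longrightarrow> j < ?n \<Longrightarrow> (A * Q2) $$ (i, j) = A $$ (i, \<sigma>2 j)"
    using permutation_matrixE[OF Q2] by metis
  \<comment> \<open>\<open>Q\<close> followed by \<open>Q1\<close> moves coordinate number
    \<open>r i\<close> to row \<open>i\<close>.\<close>
  define r where "r = inv_into UNIV (\<sigma>1 \<circ> \<sigma>)"
  have \<sigma>\<sigma>: "\<sigma>1 \<circ> \<sigma> permutes {..<?n}" using \<sigma>(1) \<sigma>1(1) by (rule permutes_compose)
  have r: "r permutes {..<?n}" unfolding r_def by (rule permutes_inv[OF \<sigma>\<sigma>])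
  have rlt: "r i < ?n" if "i < ?n" for i using permutes_in_image[OF r, of i] that by simp
  have req: "\<sigma>1 (\<sigma> (r i)) = i" for i
    using permutes_inverses(1)[OF \<sigma>\<sigma>, of i] by (simp add: r_def)
  have len: "length us = ?n" using P cols by (metis carrier_matD(2) cols_length length_map)
  show thesis
  proof
    show "w extreme_point_of S" by fact
    have "bij_betw ?e {..<?n} UNIV" by (rule bij_betw_from_nat_into_finite) simp
    then show "bij_betw (?e \<circ> r) {..<?n} UNIV"
      using bij_betw_trans[OF permutes_imp_bij[OF r]] by blast
    have "bij_betw ((!) us) {..<?n} (set us)" using us(1) len by (simp add: bij_betw_nth)
    then show "bij_betw ((!) us \<circ> \<sigma>2) {..<?n} {u. u extreme_point_of S \<and> u \<noteq> w}"
      using bij_betw_trans[OF permutes_imp_bij[OF \<sigma>2(1)]] us(2) by metis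
    show M: "Q1 * P * Q2 \<in> carrier_mat ?n ?n" using P \<sigma>1(2) \<sigma>2(2) by auto
    fix i j assume ij: "i < ?n" "j < ?n"
    have j2: "\<sigma>2 j < ?n" using permutes_in_image[OF \<sigma>2(1), of j] ij by simp
    have s: "\<sigma> (r i) < ?n" using permutes_in_image[OF \<sigma>(1), of "r i"] rlt[OF ij(1)] by simp
    have "(Q1 * P * Q2) $$ (i, j) = (Q1 * P) $$ (\<sigma>1 (\<sigma> (r i)), \<sigma>2 j)"
      using \<sigma>2(3)[of "Q1 * P" i j] P \<sigma>1(2) ij req by simp
    also have "\<dots> = P $$ (\<sigma> (r i), \<sigma>2 j)" using \<sigma>1(3)[OF P s j2] .
    also have "\<dots> = vec_index (cols P ! \<sigma>2 j) (\<sigma> (r i))" using P j2 s by simp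
    also have "\<dots> = vec_index (Q *\<^sub>v to_coords (add_mod2 (us ! \<sigma>2 j) w)) (\<sigma> (r i))"
      unfolding cols using len j2 by simp
    also have "\<dots> = vec_index (to_coords (add_mod2 (us ! \<sigma>2 j) w)) (r i)"
      using rlt[OF ij(1)] by (intro \<sigma>(3)) (simp_all add: to_coords_def)
    also have "\<dots> = add_mod2 (us ! \<sigma>2 j) w $ ?e (r i)"
      using rlt[OF ij(1)] by (simp add: to_coords_def)
    finally show "(Q1 * P * Q2) $$ (i, j) = add_mod2 (((!) us \<circ> \<sigma>2) j) w $ (?e \<circ> r) i" by simp
  qed
qed

lemma of_coords_inner:
  assumes "dim_vec x \<le> CARD('n)" "dim_vec y = dim_vec x"
  shows "(of_coords x :: real^'n) \<bullet> of_coords y = (\<Sum>i<dim_vec x. vec_index x i * vec_index y i)"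
proof -
  let ?e = "from_nat_into (UNIV :: 'n set)"
  have "bij_betw ?e {..<CARD('n)} UNIV" by (rule bij_betw_from_nat_into_finite) simp
  then have inj: "?e i = ?e j \<longleftrightarrow> i = j" if "i < dim_vec x" "j < dim_vec x" for i j
    using that assms by (auto simp: bij_betw_def inj_on_def)
  have "(of_coords x :: real^'n) \<bullet> of_coords y
      = (\<Sum>i<dim_vec x. \<Sum>j<dim_vec x. vec_index x i * vec_index y j * of_bool (?e i = ?e j))"
    unfolding of_coords_def assms(2) inner_sum_left unfolding inner_sum_right
    by (intro sum.cong) (simp_all add: inner_axis_axis)
  also have "\<dots> = (\<Sum>i<dim_vec x. \<Sum>j<dim_vec x. if i = j then vec_index x i * vec_index y j else 0)"
    using inj by (intro sum.cong) auto
  also have "\<dots> = (\<Sum>i<dim_vec x. vec_index x i * vec_index y i)"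
    by (intro sum.cong) simp_all
  finally show ?thesis .
qed

text \<open>Adding \<open>w\<close> mod 2 is the reflection of the cube taking \<open>w\<close> to
  the origin; the factor, 1 or -1, is its sign at \<open>k\<close>. This makes the columns linear in
  \<open>u - w\<close>.\<close>

lemma add_mod2_coord:
  assumes "u $ k = 0 \<or> u $ k = 1" "w $ k = 0 \<or> w $ k = 1"
  shows "add_mod2 u w $ k = (1 - 2 * w $ k) * (u - w) $ k"
  using assms by (auto simp: add_mod2_def)

lemma acute_block_structure:
  fixes V :: "(real^'n) set"
  assumes nv: "nonobtuse_vertices V q"
    and blocks: "fully_indecomposable_blocks (convex hull V) As"
    and acute: "\<forall>A\<in>set As. acute (component_simplex A :: (real^'n) set)"
  obtains w bl rho where "acute_block_vertices V q w bl rho"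
proof -
  interpret nonobtuse_vertices V q by fact
  let ?n = "CARD('n)"
  have "\<not> affine_dependent V"
    using barycentric_gradients_affine_independent[OF bary finite_V] by simp
  then have ext: "x extreme_point_of (convex hull V) \<longleftrightarrow> x \<in> V" for x
    by (rule extreme_point_of_convex_hull_affine_independent)
  obtain P Q1 Q2 where P: "matrix_representation (convex hull V) P"
      "permutation_matrix ?n Q1" "permutation_matrix ?n Q2"
    and but: "block_upper_triangular As (Q1 * P * Q2)"
    using blocks unfolding fully_indecomposable_blocks_def by blast
  define M where "M = Q1 * P * Q2"
  obtain w \<kappa> \<tau> where w: "w \<in> V"
    and \<kappa>: "bij_betw \<kappa> {..<?n} (UNIV :: 'n set)"
    and \<tau>: "bij_betw \<tau> {..<?n} (V - {w})"
    and M: "M \<in> carrier_mat ?n ?n"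
    and ent: "\<And>i j. i < ?n \<Longrightarrow> j < ?n \<Longrightarrow> M $$ (i, j) = add_mod2 (\<tau> j) w $ \<kappa> i"
    using matrix_representation_entries[OF P] unfolding ext M_def set_diff_eq singleton_iff by blast
  obtain \<beta> where \<beta>0: "\<And>i j. i < ?n \<Longrightarrow> j < ?n \<Longrightarrow> \<beta> j < \<beta> i \<Longrightarrow> M $$ (i, j) = 0"
    and \<beta>l: "\<And>i. i < ?n \<Longrightarrow> \<beta> i < length As"
    and \<beta>b: "\<And>m. m < length As \<Longrightarrow> \<exists>d. {i. i < ?n \<and> \<beta> i = m} = {d..<d + dim_row (As ! m)}
        \<and> dim_col (As ! m) = dim_row (As ! m)
        \<and> (\<forall>i<dim_row (As ! m). \<forall>j<dim_row (As ! m). (As ! m) $$ (i, j) = M $$ (d + i, d + j))"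
    using block_upper_triangular_index[OF but] M unfolding M_def[symmetric] by auto
  \<comment> \<open>\<open>Suc\<close> reserves the number 0 for \<open>w\<close>, which precedes
    all blocks.\<close>
  define bl where "bl = (\<lambda>u. if u = w then 0 else Suc (\<beta> (inv_into {..<?n} \<tau> u)))"
  define rho where "rho = (\<lambda>k. Suc (\<beta> (inv_into {..<?n} \<kappa> k)))"
  have injs: "inj_on \<tau> {..<?n}" "inj_on \<kappa> {..<?n}" using \<kappa> \<tau> by (auto simp: bij_betw_def)
  have \<tau>V: "\<tau> j \<in> V" "\<tau> j \<noteq> w" if "j < ?n" for j
    using \<tau> that by (auto simp: bij_betw_def)
  have bl: "bl (\<tau> j) = Suc (\<beta> j)" if "j < ?n" for j
    using \<tau>V that injs by (simp add: bl_def inv_into_f_f)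
  have rho: "rho (\<kappa> i) = Suc (\<beta> i)" if "i < ?n" for i
    using that injs by (simp add: rho_def inv_into_f_f)
  have V_cases: "\<exists>j<?n. u = \<tau> j" if "u \<in> V" "u \<noteq> w" for u
    using that \<tau> by (auto simp: bij_betw_def image_iff set_eq_iff)
  have k_cases: "\<exists>i<?n. k = \<kappa> i" for k
    using \<kappa> by (auto simp: bij_betw_def image_iff set_eq_iff)
  \<comment> \<open>\<open>R\<close> is left open to cover both the blocks before a given one and
    that block itself.\<close>
  have V_block: "{u \<in> V. u \<noteq> w \<and> R (bl u)} = \<tau> ` {j. j < ?n \<and> R (Suc (\<beta> j))}" for R
    using V_cases \<tau>V bl by (fastforce simp: image_iff)
  have k_block: "{k. R (rho k)} = \<kappa> ` {i. i < ?n \<and> R (Suc (\<beta> i))}" for R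
    using k_cases rho by (fastforce simp: image_iff)
  interpret block_triangular_vertices V q w bl rho
  proof
    show "w \<in> V" by fact
    show "bl w = 0" by (simp add: bl_def)
    show "bl u > 0" if "u \<in> V" "u \<noteq> w" for u using that by (simp add: bl_def)
    show "u $ k = w $ k" if uk: "u \<in> V" "bl u < rho k" for u k
    proof (cases "u = w")
      case False
      obtain j where j: "j < ?n" "u = \<tau> j" using V_cases[OF uk(1) False] by blast
      obtain i where i: "i < ?n" "k = \<kappa> i" using k_cases[of k] by blast
      have "add_mod2 u w $ k = 0"
        using \<beta>0[OF i(1) j(1)] ent[OF i(1) j(1)] uk(2) bl[OF j(1)] rho[OF i(1)] i j by simp
      then show ?thesis by (simp add: add_mod2_def split: if_splits)
    qed simp
    show "card {u \<in> V. u \<noteq> w \<and> bl u < m} = card {k. rho k < m}" for m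
      unfolding V_block[of "\<lambda>l. l < m"] k_block[of "\<lambda>l. l < m"]
      using injs by (simp add: card_image inj_on_subset[of _ "{..<?n}"] subset_iff)
  qed
  have component: "\<exists>\<psi> :: real^'n \<Rightarrow> real^'n. linear \<psi> \<and> (\<forall>x y. \<psi> x \<bullet> \<psi> y = bpart (bl a) x \<bullet> y)
      \<and> acute (convex hull ((\<lambda>u. \<psi> (u - w)) ` insert w {u \<in> V. bl u = bl a}))"
    if a: "a \<in> V" "bl a > 0" for a
  proof -
    obtain j where j: "j < ?n" "a = \<tau> j" using V_cases[OF a(1)] a(2) by (auto simp: bl_def split: if_splits)
    define m where "m = \<beta> j"
    have bla: "bl a = Suc m" using j bl by (simp add: m_def)
    have m: "m < length As" using \<beta>l j by (simp add: m_def)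
    define A where "A = As ! m"
    define s where "s = dim_row A"
    obtain d where d: "{i. i < ?n \<and> \<beta> i = m} = {d..<d + s}" and col: "dim_col A = s"
      and entA: "\<And>i j. i < s \<Longrightarrow> j < s \<Longrightarrow> A $$ (i, j) = M $$ (d + i, d + j)"
      using \<beta>b[OF m] unfolding A_def s_def by blast
    have lt: "d + i < ?n" if "i < s" for i
    proof -
      have "d + i \<in> {d..<d + s}" using that by simp
      then show ?thesis unfolding d[symmetric] by simp
    qed
    have sn: "s \<le> ?n" using lt[of "s - 1"] by (cases s) auto
    have shift: "{d..<d + s} = (\<lambda>i. d + i) ` {..<s}"
      by (simp add: lessThan_atLeast0 add.commute)
    \<comment> \<open>\<open>\<phi>\<close> lists the coordinates of the block in matrix order, with
      the signs of the reflection at \<open>w\<close>, so that \<open>u - w\<close> becomes a column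
      of \<open>A\<close> for \<open>u\<close> in the block. The signs do not affect inner
      products.\<close>
    define \<phi> where "\<phi> = (\<lambda>x :: real^'n. Matrix.vec s (\<lambda>i. (1 - 2 * w $ \<kappa> (d + i)) * x $ \<kappa> (d + i)))"
    define \<psi> where "\<psi> = (\<lambda>x. of_coords (\<phi> x) :: real^'n)"
    have "linear \<psi>"
      unfolding \<psi>_def of_coords_def \<phi>_def
      by (rule linearI) (simp_all add: sum.distrib distrib_left scaleR_left_distrib scaleR_sum_right mult.left_commute)
    moreover have "\<psi> x \<bullet> \<psi> y = bpart (bl a) x \<bullet> y" for x y
    proof -
      have "\<psi> x \<bullet> \<psi> y = (\<Sum>i<s. x $ \<kappa> (d + i) * y $ \<kappa> (d + i))"
      proof -
        have "(1 - 2 * w $ k) * (1 - 2 * w $ k) = 1" for k using cube[OF w(1), of k] by auto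
        then have sq: "((1 - 2 * w $ k) * b) * ((1 - 2 * w $ k) * c) = b * c" for k b c
          by (metis (no_types, opaque_lifting) mult.assoc mult.left_commute mult_1)
        show ?thesis
          unfolding \<psi>_def by (subst of_coords_inner) (simp_all add: \<phi>_def sn sq del: mult_cancel_left mult_cancel_right)
      qed
      also have "\<dots> = (\<Sum>i\<in>{d..<d + s}. x $ \<kappa> i * y $ \<kappa> i)"
        unfolding shift by (simp add: sum.reindex)
      also have "\<dots> = (\<Sum>k\<in>\<kappa> ` {d..<d + s}. x $ k * y $ k)"
        using injs(2) by (subst sum.reindex) (auto simp: d[symmetric] inj_on_def)
      also have "\<kappa> ` {d..<d + s} = {k. rho k = Suc m}"
        unfolding k_block[of "\<lambda>l. l = Suc m"] d[symmetric] by simp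
      also have "(\<Sum>k\<in>{k. rho k = Suc m}. x $ k * y $ k) = bpart (bl a) x \<bullet> y"
        unfolding inner_vec_def bla by (rule sum.mono_neutral_cong_left) (auto simp: bpart_def)
      finally show ?thesis .
    qed
    moreover have "acute (convex hull ((\<lambda>u. \<psi> (u - w)) ` insert w {u \<in> V. bl u = bl a}))"
    proof -
      have J: "{u \<in> V. bl u = bl a} = (\<lambda>j. \<tau> (d + j)) ` {..<s}"
      proof -
        have "{u \<in> V. bl u = bl a} = {u \<in> V. u \<noteq> w \<and> bl u = Suc m}"
          using bla by (auto simp: bl_def)
        also have "\<dots> = \<tau> ` {d..<d + s}"
          unfolding V_block[of "\<lambda>l. l = Suc m"] d[symmetric] by simp
        finally show ?thesis by (simp add: shift image_image)
      qed
      have "col A j = \<phi> (\<tau> (d + j) - w)" if j: "j < s" for j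
      proof (rule eq_vecI)
        fix i assume "i < dim_vec (\<phi> (\<tau> (d + j) - w))"
        then have i: "i < s" by (simp add: \<phi>_def)
        have "vec_index (col A j) i = add_mod2 (\<tau> (d + j)) w $ \<kappa> (d + i)"
          using i j col entA ent lt by (simp add: s_def)
        also have "\<dots> = (1 - 2 * w $ \<kappa> (d + i)) * (\<tau> (d + j) - w) $ \<kappa> (d + i)"
          using cube \<tau>V lt j w by (intro add_mod2_coord) auto
        finally show "vec_index (col A j) i = vec_index (\<phi> (\<tau> (d + j) - w)) i"
          using i by (simp add: \<phi>_def)
      qed (simp add: \<phi>_def s_def)
      then have "set (cols A) = (\<lambda>j. \<phi> (\<tau> (d + j) - w)) ` {..<s}"
        by (auto simp: cols_def col image_iff)
      then have "(component_simplex A :: (real^'n) set)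
          = convex hull ((\<lambda>u. \<psi> (u - w)) ` insert w {u \<in> V. bl u = bl a})"
        using linear_0[OF \<open>linear \<psi>\<close>]
        by (simp add: component_simplex_def J image_image \<psi>_def)
      moreover have "acute (component_simplex A :: (real^'n) set)"
        using acute m by (simp add: A_def)
      ultimately show ?thesis by simp
    qed
    ultimately show ?thesis by blast
  qed
  have "acute_block_vertices V q w bl rho"
  proof
    fix a assume a: "a \<in> V" "bl a > 0"
    obtain \<psi> :: "real^'n \<Rightarrow> real^'n" where \<psi>: "linear \<psi>"
        "\<And>x y. \<psi> x \<bullet> \<psi> y = bpart (bl a) x \<bullet> y"
        "acute (convex hull ((\<lambda>u. \<psi> (u - w)) ` insert w {u \<in> V. bl u = bl a}))"
      using component[OF a] by blast
    show "bpart (bl a) (\<Sum>c | c \<in> V \<and> bl c = bl a. q c) \<bullet> q a > 0"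
      by (rule acute_component_base[OF \<psi>(1,2) a(2) \<psi>(3) a(1) refl])
    show "bpart (bl a) (q c) \<bullet> q a < 0" if "c \<in> V" "bl a = bl c" "a \<noteq> c" for c
      using acute_component_block[OF \<psi>(1,2) a(2) \<psi>(3) a(1) refl] that by simp
  qed
  then show thesis by (rule that)
qed

section \<open>Neighbours at a facet\<close>

text \<open>The open set \<open>?U\<close> restricts only the coordinates other than
  \<open>k\<close> and meets the hyperplane. The intersection lies in the cube and has the dimension
  of the hyperplane.\<close>

lemma cube_coordinate_facet:
  assumes c: "c = 0 \<or> c = (1::real)"
  shows "cbox 0 1 \<inter> {x. axis k 1 \<bullet> x = c} facet_of cbox 0 (1 :: real^'n)"
proof -
  let ?C = "cbox 0 (1 :: real^'n)" and ?H = "{x :: real^'n. axis k 1 \<bullet> x = c}"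
  let ?U = "\<Inter>i\<in>- {k}. {x :: real^'n. 0 < x $ i \<and> x $ i < 1}"
  have face: "?C \<inter> ?H face_of ?C"
    using c
  proof
    assume "c = 0"
    then show ?thesis
      by (intro face_of_Int_supporting_hyperplane_ge) (auto simp: mem_box_cart inner_axis')
  next
    assume "c = 1"
    then show ?thesis
      by (intro face_of_Int_supporting_hyperplane_le) (auto simp: mem_box_cart inner_axis')
  qed
  have "open ?U"
    by (intro open_INT ballI open_Collect_conj open_Collect_less continuous_intros) auto
  moreover have wit: "(\<chi> i. if i = k then c else 1 / 2) \<in> ?H \<inter> ?U"
    by (simp add: inner_axis')
  ultimately have "aff_dim (?H \<inter> ?U) = aff_dim ?H"
    by (intro aff_dim_convex_Int_open) (auto simp: convex_hyperplane)
  moreover have "?H \<inter> ?U \<subseteq> ?C \<inter> ?H"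
  proof
    fix x assume x: "x \<in> ?H \<inter> ?U"
    then have "0 \<le> x $ i \<and> x $ i \<le> 1" for i
      using c by (cases "i = k") (auto simp: inner_axis' intro: less_imp_le)
    then show "x \<in> ?C \<inter> ?H" using x by (auto simp: mem_box_cart)
  qed
  ultimately have "aff_dim (?C \<inter> ?H) = aff_dim ?H"
    using aff_dim_subset[of "?H \<inter> ?U" "?C \<inter> ?H"] aff_dim_subset[of "?C \<inter> ?H" ?H] by auto
  moreover have "aff_dim ?H = int CARD('n) - 1"
    by (subst aff_dim_hyperplane) (simp_all add: axis_eq_0_iff)
  moreover have "aff_dim ?C = int CARD('n)"
  proof -
    have "(\<chi> i. 1 / 2) \<in> box 0 (1 :: real^'n)" by (simp add: mem_box_cart)
    then have "interior ?C \<noteq> {}" by auto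
    then show ?thesis using aff_dim_nonempty_interior[of ?C] by simp
  qed
  ultimately show ?thesis
    unfolding facet_of_def using face wit \<open>?H \<inter> ?U \<subseteq> ?C \<inter> ?H\<close> by auto
qed

text \<open>The last clause recovers the vertices other than the apex from \<open>F\<close> alone,
  so that two simplices over \<open>F\<close> share them.\<close>

lemma nonobtuse_simplex_facet:
  fixes T F :: "(real^'n) set"
  assumes "zero_one_simplex T" "nonobtuse T" "F facet_of T"
  obtains V q p where "nonobtuse_vertices V q" "T = convex hull V" "p \<in> V"
    "F = convex hull (V - {p})" "V - {p} = {x. x extreme_point_of F}"
proof -
  obtain V where V: "\<And>v i. v \<in> V \<Longrightarrow> v $ i = 0 \<or> v $ i = 1" "\<not> affine_dependent V"
      "card V = CARD('n) + 1" "T = convex hull V"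
    using assms(1) unfolding zero_one_simplex_def by auto
  obtain p where p: "p \<in> V" "F = convex hull (V - {p})"
    using facet_of_convex_hull_affine_independent[OF V(2)] assms(3) V(4) by blast
  obtain q where bg: "barycentric_gradients V id q"
    using barycentric_gradients_exist[OF V(2)] V(3) by auto
  have fin: "finite V" using V(3) card.infinite by fastforce
  have c0: "card V = DIM(real^'n) + 1" using V(3) by simp
  have span: "q a \<in> span {id b - id c | b c. b \<in> V \<and> c \<in> V}" for a
  proof -
    have "span ((\<lambda>x. x - p) ` (V - {p})) \<subseteq> span {id b - id c | b c. b \<in> V \<and> c \<in> V}"
      using p(1) by (intro span_mono) auto
    then show ?thesis using span_vertex_differences[OF V(2) c0 p(1)] by auto
  qed
  have "nonobtuse_vertices V q"
  proof
    show "q a \<bullet> q b \<le> 0" if "a \<in> V" "b \<in> V" "a \<noteq> b" for a b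
      using nonobtuse_gradients[OF bg fin that span] assms(2) V(4) by simp
  qed (use bg V in auto)
  moreover have "V - {p} = {x. x extreme_point_of F}"
    using extreme_point_of_convex_hull_affine_independent[of "V - {p}"] affine_independent_Diff[OF V(2)]
    unfolding p(2) by blast
  ultimately show thesis using that V(4) p by blast
qed

theorem theorem6p9:
  fixes S F :: "(real^'n) set" and As :: "real mat list"
  assumes "zero_one_simplex S" and "nonobtuse S"
    and "fully_indecomposable_blocks S As"
    and "\<forall>A\<in>set As. acute (component_simplex A :: (real^'n) set)"
    and "F facet_of S"
    and "\<not> (\<exists>G. G facet_of cbox 0 (1 :: real^'n) \<and> F \<subseteq> G)"
  shows "\<exists>\<^sub>\<le>\<^sub>1 T. zero_one_simplex T \<and> nonobtuse T \<and> T \<noteq> S \<and> F facet_of T"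
proof -
  obtain V q v where nv: "nonobtuse_vertices V q" and S: "S = convex hull V" and v: "v \<in> V"
    and F: "F = convex hull (V - {v})" and U: "V - {v} = {x. x extreme_point_of F}"
    using nonobtuse_simplex_facet[OF assms(1,2,5)] by blast
  obtain w bl rho where "acute_block_vertices V q w bl rho"
    using acute_block_structure[OF nv] assms(3,4) S by blast
  then interpret S: acute_block_vertices V q w bl rho .
  obtain u where u: "u \<in> V - {v}"
  proof -
    have "V \<noteq> {v}" using S.card_V by auto
    then show thesis using v that by blast
  qed
  \<comment> \<open>A coordinate constant on \<open>V - {v}\<close> would put \<open>F\<close> into
    a facet of the cube.\<close>
  have interior: "\<exists>x\<in>V - {v}. \<exists>y\<in>V - {v}. x $ k \<noteq> y $ k" for k
  proof (rule ccontr)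
    assume *: "\<not> ?thesis"
    have "V - {v} \<subseteq> cbox 0 1 \<inter> {x. axis k 1 \<bullet> x = u $ k}"
    proof
      fix x assume x: "x \<in> V - {v}"
      have "0 \<le> x $ i \<and> x $ i \<le> 1" for i using S.cube[of x i] x by auto
      moreover have "x $ k = u $ k" using * x u by blast
      ultimately show "x \<in> cbox 0 1 \<inter> {x. axis k 1 \<bullet> x = u $ k}"
        by (simp add: mem_box_cart inner_axis')
    qed
    then have "F \<subseteq> cbox 0 1 \<inter> {x. axis k 1 \<bullet> x = u $ k}"
      unfolding F by (intro hull_minimal convex_Int convex_box convex_hyperplane) auto
    then show False
      using cube_coordinate_facet[of "u $ k" k] S.cube[of u k] u assms(6) by blast
  qed
  \<comment> \<open>The formula for the apex does not mention \<open>T\<close>, which yields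
    uniqueness.\<close>
  have neighbour: "\<exists>p. T = convex hull (insert p (V - {v}))
      \<and> (\<forall>k. p $ k = (if q v $ k = 0 then v $ k else if q v $ k > 0 then 0 else 1))"
    if T: "zero_one_simplex T \<and> nonobtuse T \<and> T \<noteq> S \<and> F facet_of T" for T
  proof -
    obtain V' q' p where nv': "nonobtuse_vertices V' q'" and T': "T = convex hull V'" and p: "p \<in> V'"
      and U': "V' - {p} = V - {v}"
      using nonobtuse_simplex_facet[of T F] T U by metis
    interpret T: nonobtuse_vertices V' q' by fact
    have V': "V' = insert p (V - {v})" using p U' by blast
    define \<alpha> where "\<alpha> = q' p \<bullet> (v - u)"
    \<comment> \<open>Both gradients are normal to the common facet \<open>F\<close>: in the dual
      expansion of \<open>q' p\<close> over \<open>V\<close> only the term of \<open>v\<close>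
      survives.\<close>
    have par: "q' p = \<alpha> *\<^sub>R q v"
    proof -
      have "q' p = (\<Sum>b\<in>V. (q' p \<bullet> (b - u)) *\<^sub>R q b)"
        using barycentric_gradients_dual_expansion[OF S.bary, of u "q' p"] S.card_V u by simp
      also have "\<dots> = \<alpha> *\<^sub>R q v + (\<Sum>b\<in>V - {v}. (q' p \<bullet> (b - u)) *\<^sub>R q b)"
        using v S.finite_V by (simp add: sum.remove \<alpha>_def)
      also have "(\<Sum>b\<in>V - {v}. (q' p \<bullet> (b - u)) *\<^sub>R q b) = 0"
      proof (intro sum.neutral ballI)
        fix b assume "b \<in> V - {v}"
        then have "b \<in> V' - {p}" "u \<in> V' - {p}" using u U' by auto
        then have "q' p \<bullet> (b - u) = 0" using T.dual[of p b u] p by auto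
        then show "(q' p \<bullet> (b - u)) *\<^sub>R q b = 0" by simp
      qed
      finally show ?thesis by simp
    qed
    then have \<alpha>: "\<alpha> \<noteq> 0" using T.gradient_nonzero[OF p] by auto
    have kernel: "q' p $ k = 0 \<longleftrightarrow> q v $ k = 0" for k using par \<alpha> by simp
    \<comment> \<open>The altitude argument runs in \<open>T\<close>, but its hypothesis on pairs of
      facet vertices comes from the cliques of \<open>S\<close>.\<close>
    have pv: "p $ k = v $ k" if "q v $ k = 0" for k
    proof (rule T.apex_on_normal_kernel[OF p])
      show "q' p $ k = 0" using that kernel by simp
      show "\<exists>x\<in>V' - {p}. \<exists>y\<in>V' - {p}. x $ k \<noteq> y $ k" for k unfolding U' by (rule interior)
      show "x $ k = v $ k" if "x \<in> V' - {p}" "y \<in> V' - {p}" "x \<noteq> y"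
        "\<And>k. q' p $ k = 0 \<Longrightarrow> x $ k = y $ k" "q' p $ k = 0" for x y k
        using that v S.agree_on_gradient_kernel[of v x y k] unfolding U' kernel by blast
    qed
    \<comment> \<open>For positive \<open>\<alpha>\<close> the two gradients have equal signs in
      every coordinate, so the apexes coincide where these are nonzero; with \<open>pv\<close> this
      gives \<open>T = S\<close>.\<close>
    have "\<alpha> < 0"
    proof (rule ccontr)
      assume "\<not> \<alpha> < 0"
      then have pos: "\<alpha> > 0" using \<alpha> by simp
      have "p $ k = v $ k" for k
      proof -
        consider "q v $ k = 0" | "q v $ k > 0" | "q v $ k < 0" by linarith
        then show ?thesis
        proof cases
          case 1
          then show ?thesis by (rule pv)
        next
          case 2
          then have "q' p $ k > 0" using par pos by simp
          then show ?thesis using T.gradient_pos_imp[OF p] S.gradient_pos_imp[OF v 2] by simp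
        next
          case 3
          then have "q' p $ k < 0" using par pos by (simp add: mult_pos_neg)
          then show ?thesis using T.gradient_neg_imp[OF p] S.gradient_neg_imp[OF v 3] by simp
        qed
      qed
      then have "p = v" by (simp add: Finite_Cartesian_Product.vec_eq_iff)
      then have "V' = V" using V' v by blast
      then show False using T T' S by simp
    qed
    \<comment> \<open>Across \<open>F\<close> the signs are reversed, which flips the apex on the
      support of the normal.\<close>
    have "p $ k = (if q v $ k = 0 then v $ k else if q v $ k > 0 then 0 else 1)" for k
    proof -
      consider "q v $ k = 0" | "q v $ k > 0" | "q v $ k < 0" by linarith
      then show ?thesis
      proof cases
        case 1
        then show ?thesis by (simp add: pv)
      next
        case 2
        then have "q' p $ k < 0" using par \<open>\<alpha> < 0\<close> by (simp add: mult_neg_pos)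
        then show ?thesis using T.gradient_neg_imp[OF p] 2 by simp
      next
        case 3
        then have "q' p $ k > 0" using par \<open>\<alpha> < 0\<close> by (simp add: mult_neg_neg)
        then show ?thesis using T.gradient_pos_imp[OF p] 3 by simp
      qed
    qed
    then show ?thesis using T' V' by blast
  qed
  show ?thesis
  proof (rule Uniq_I)
    fix T T'
    assume "zero_one_simplex T \<and> nonobtuse T \<and> T \<noteq> S \<and> F facet_of T"
      and "zero_one_simplex T' \<and> nonobtuse T' \<and> T' \<noteq> S \<and> F facet_of T'"
    then obtain p p' where p: "T = convex hull (insert p (V - {v}))" "T' = convex hull (insert p' (V - {v}))"
      and "\<forall>k. p $ k = p' $ k"
      using neighbour by (metis (no_types, lifting))
    then have "p = p'" by (simp add: Finite_Cartesian_Product.vec_eq_iff)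
    then show "T = T'" using p by simp
  qed
qed

end
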